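(* Let $\Gamma$ be a countable acylindrically hyperbolic group. Then there exist a measure space $(\Omega,\mu)$ and a closed subspace $E\subset L^1(\Omega,\mu)$ such that $\Gamma$ admits an affine uniformly Lipschitz action on $E$ with unbounded orbits.
   Context: A group $\Gamma$ is acylindrically hyperbolic if it admits a non-elementary acylindrical action by isometries on a (geodesic, Gromov) hyperbolic metric space $(S,d)$. Here the action is acylindrical if for every $\varepsilon>0$ there exist $R,N>0$ such that for all $x,y\in S$ with $d(x,y)\geq R$, there are at most $N$ elements $s\in\Gamma$ with $d(x,sx)\leq\varepsilon$ and $d(y,sy)\leq\varepsilon$. The action is non-elementary if the limit set of $\Gamma$ in the Gromov boundary $\partial S$ contains more than two points. $L^1(\Omega,\mu)$ is the Banach space of (classes of) real-valued integrable functions, and $E$ carries the induced norm. $\mathcal{B}(E)$ denotes the algebra of bounded linear operators on $E$. An affine action of $\Gamma$ on a Banach space $E$ is given by a representation $\pi:\Gamma\to\mathcal{B}(E)$ (that is, $\pi(e)=\mathrm{id}_E$ and $\pi(st)=\pi(s)\pi(t)$ for all $s,t\in\Gamma$) and a map $b:\Gamma\to E$ satisfying the cocycle identity $b(st)=\pi(s)b(t)+b(s)$ for all $s,t\in\Gamma$; the action is $s\cdot v=\pi(s)v+b(s)$ for $s\in\Gamma$, $v\in E$. The action is uniformly Lipschitz if and only if $\pi$ is uniformly bounded: $\sup_{s\in\Gamma}\|\pi(s)\|<\infty$. A uniformly Lipschitz affine action has bounded orbits if and only if $b$ is bounded; thus it has unbounded orbits if and only if $\sup_{s\in\Gamma}\|b(s)\|_E=\infty$.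 *)

theory Defs
  imports "HOL-Analysis.Analysis" "HOL-Algebra.Group_Action"
begin

section \<open>Hyperbolic metric spaces and the Gromov boundary\<close>

definition geodesic_space :: "'s set \<Rightarrow> ('s \<Rightarrow> 's \<Rightarrow> real) \<Rightarrow> bool" where
  "geodesic_space S d \<longleftrightarrow>
     (\<forall>x\<in>S. \<forall>y\<in>S. \<exists>\<gamma> :: real \<Rightarrow> 's.
        \<gamma> 0 = x \<and> \<gamma> (d x y) = y \<and> \<gamma> ` {0..d x y} \<subseteq> S \<and>
        (\<forall>s\<in>{0..d x y}. \<forall>t\<in>{0..d x y}. d (\<gamma> s) (\<gamma> t) = \<bar>s - t\<bar>))"

definition gromov_product :: "('s \<Rightarrow> 's \<Rightarrow> real) \<Rightarrow> 's \<Rightarrow> 's \<Rightarrow> 's \<Rightarrow> real" where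
  "gromov_product d w x y = (d w x + d w y - d x y) / 2"

definition gromov_hyperbolic :: "'s set \<Rightarrow> ('s \<Rightarrow> 's \<Rightarrow> real) \<Rightarrow> bool" where
  "gromov_hyperbolic S d \<longleftrightarrow>
     (\<exists>\<delta>\<ge>0. \<forall>w\<in>S. \<forall>x\<in>S. \<forall>y\<in>S. \<forall>z\<in>S.
        gromov_product d w x z \<ge> min (gromov_product d w x y) (gromov_product d w y z) - \<delta>)"

definition hyperbolic_space :: "'s set \<Rightarrow> ('s \<Rightarrow> 's \<Rightarrow> real) \<Rightarrow> bool" where
  "hyperbolic_space S d \<longleftrightarrow> Metric_space S d \<and> geodesic_space S d \<and> gromov_hyperbolic S d"

text \<open>
  Two sequences are compared through the double limit of their Gromov products.
  Changing the base point changes Gromov products by a bounded amount, so quantifying over all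
  base points is the same as choosing one.
\<close>

definition gromov_products_diverge ::
    "'s set \<Rightarrow> ('s \<Rightarrow> 's \<Rightarrow> real) \<Rightarrow> (nat \<Rightarrow> 's) \<Rightarrow> (nat \<Rightarrow> 's) \<Rightarrow> bool" where
  "gromov_products_diverge S d x y \<longleftrightarrow>
     (\<forall>w\<in>S. filterlim (\<lambda>(i, j). gromov_product d w (x i) (y j)) at_top
        (sequentially \<times>\<^sub>F sequentially))"

definition gromov_sequences :: "'s set \<Rightarrow> ('s \<Rightarrow> 's \<Rightarrow> real) \<Rightarrow> (nat \<Rightarrow> 's) set" where
  "gromov_sequences S d = {x. range x \<subseteq> S \<and> gromov_products_diverge S d x x}"

definition gromov_boundary :: "'s set \<Rightarrow> ('s \<Rightarrow> 's \<Rightarrow> real) \<Rightarrow> (nat \<Rightarrow> 's) set set" where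
  "gromov_boundary S d = gromov_sequences S d //
     {(x, y). x \<in> gromov_sequences S d \<and> y \<in> gromov_sequences S d \<and> gromov_products_diverge S d x y}"

section \<open>Acylindrically hyperbolic groups\<close>

definition isometric_action ::
    "('g, 'm) monoid_scheme \<Rightarrow> 's set \<Rightarrow> ('s \<Rightarrow> 's \<Rightarrow> real) \<Rightarrow> ('g \<Rightarrow> 's \<Rightarrow> 's) \<Rightarrow> bool" where
  "isometric_action G S d \<phi> \<longleftrightarrow>
     group_action G S \<phi> \<and> (\<forall>g\<in>carrier G. \<forall>x\<in>S. \<forall>y\<in>S. d (\<phi> g x) (\<phi> g y) = d x y)"

definition acylindrical_action ::
    "('g, 'm) monoid_scheme \<Rightarrow> 's set \<Rightarrow> ('s \<Rightarrow> 's \<Rightarrow> real) \<Rightarrow> ('g \<Rightarrow> 's \<Rightarrow> 's) \<Rightarrow> bool" where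
  "acylindrical_action G S d \<phi> \<longleftrightarrow>
     (\<forall>\<epsilon>>0. \<exists>R>0. \<exists>N>(0::nat). \<forall>x\<in>S. \<forall>y\<in>S. d x y \<ge> R \<longrightarrow>
        finite {s \<in> carrier G. d x (\<phi> s x) \<le> \<epsilon> \<and> d y (\<phi> s y) \<le> \<epsilon>} \<and>
        card {s \<in> carrier G. d x (\<phi> s x) \<le> \<epsilon> \<and> d y (\<phi> s y) \<le> \<epsilon>} \<le> N)"

text \<open>
  The boundary points that are limits of sequences taken from an orbit; since the action is
  isometric, the orbits of all points of the space have the same limits.
\<close>

definition limit_set ::
    "('g, 'm) monoid_scheme \<Rightarrow> 's set \<Rightarrow> ('s \<Rightarrow> 's \<Rightarrow> real) \<Rightarrow> ('g \<Rightarrow> 's \<Rightarrow> 's) \<Rightarrow> (nat \<Rightarrow> 's) set set" where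
  "limit_set G S d \<phi> =
     {\<xi> \<in> gromov_boundary S d. \<exists>p\<in>S. \<exists>x\<in>\<xi>. range x \<subseteq> orbit G \<phi> p}"

definition non_elementary_action ::
    "('g, 'm) monoid_scheme \<Rightarrow> 's set \<Rightarrow> ('s \<Rightarrow> 's \<Rightarrow> real) \<Rightarrow> ('g \<Rightarrow> 's \<Rightarrow> 's) \<Rightarrow> bool" where
  "non_elementary_action G S d \<phi> \<longleftrightarrow>
     infinite (limit_set G S d \<phi>) \<or> card (limit_set G S d \<phi>) > 2"

text \<open>
  HOL cannot quantify over types inside a formula. The type carrying the hyperbolic space is a
  parameter, so that a theorem assuming this predicate for a type variable covers all
  hyperbolic spaces.
\<close>

definition acylindrically_hyperbolic :: "'s itself \<Rightarrow> ('g, 'm) monoid_scheme \<Rightarrow> bool" where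
  "acylindrically_hyperbolic (_ :: 's itself) G \<longleftrightarrow> group G \<and>
     (\<exists>(S :: 's set) d \<phi>. hyperbolic_space S d \<and> isometric_action G S d \<phi> \<and>
        acylindrical_action G S d \<phi> \<and> non_elementary_action G S d \<phi>)"

section \<open>The space \<open>L\<^sup>1\<close> of classes of integrable functions\<close>

definition L1_class :: "'a measure \<Rightarrow> ('a \<Rightarrow> real) \<Rightarrow> ('a \<Rightarrow> real) set" where
  "L1_class M f = {g. integrable M f \<and> integrable M g \<and> (AE x in M. f x = g x)}"

definition L1 :: "'a measure \<Rightarrow> ('a \<Rightarrow> real) set set" where
  "L1 M = L1_class M ` {f. integrable M f}"

definition L1_rep :: "('a \<Rightarrow> real) set \<Rightarrow> 'a \<Rightarrow> real" where
  "L1_rep u = (SOME f. f \<in> u)"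

definition L1_zero :: "'a measure \<Rightarrow> ('a \<Rightarrow> real) set" where
  "L1_zero M = L1_class M (\<lambda>_. 0)"

definition L1_add :: "'a measure \<Rightarrow> ('a \<Rightarrow> real) set \<Rightarrow> ('a \<Rightarrow> real) set \<Rightarrow> ('a \<Rightarrow> real) set" where
  "L1_add M u v = L1_class M (\<lambda>x. L1_rep u x + L1_rep v x)"

definition L1_scale :: "'a measure \<Rightarrow> real \<Rightarrow> ('a \<Rightarrow> real) set \<Rightarrow> ('a \<Rightarrow> real) set" where
  "L1_scale M c u = L1_class M (\<lambda>x. c * L1_rep u x)"

definition L1_norm :: "'a measure \<Rightarrow> ('a \<Rightarrow> real) set \<Rightarrow> real" where
  "L1_norm M u = (LINT x|M. \<bar>L1_rep u x\<bar>)"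

definition L1_dist :: "'a measure \<Rightarrow> ('a \<Rightarrow> real) set \<Rightarrow> ('a \<Rightarrow> real) set \<Rightarrow> real" where
  "L1_dist M u v = (LINT x|M. \<bar>L1_rep u x - L1_rep v x\<bar>)"

lemma L1_class_eq_iff:
  assumes "integrable M f" "integrable M g"
  shows "L1_class M f = L1_class M g \<longleftrightarrow> (AE x in M. f x = g x)"
proof
  assume "L1_class M f = L1_class M g"
  moreover have "g \<in> L1_class M g" using assms by (simp add: L1_class_def)
  ultimately have "g \<in> L1_class M f" by simp
  then show "AE x in M. f x = g x" by (simp add: L1_class_def)
next
  assume *: "AE x in M. f x = g x"
  have "(AE x in M. f x = h x) \<longleftrightarrow> (AE x in M. g x = h x)" for h
    using eventually_cong[OF *, of "\<lambda>x. f x = h x" "\<lambda>x. g x = h x"] by simp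
  then show "L1_class M f = L1_class M g" using assms by (simp add: L1_class_def)
qed

lemma L1_rep_class:
  assumes "integrable M f"
  shows "integrable M (L1_rep (L1_class M f))" "AE x in M. L1_rep (L1_class M f) x = f x"
proof -
  have "f \<in> L1_class M f" using assms by (simp add: L1_class_def)
  then have "L1_rep (L1_class M f) \<in> L1_class M f" unfolding L1_rep_def by (rule someI[of "\<lambda>h. h \<in> L1_class M f"])
  then show "integrable M (L1_rep (L1_class M f))" "AE x in M. L1_rep (L1_class M f) x = f x"
    by (auto simp: L1_class_def eq_commute)
qed

lemma L1_rep:
  assumes "u \<in> L1 M"
  shows "integrable M (L1_rep u)" "L1_class M (L1_rep u) = u"
proof -
  obtain f where f: "integrable M f" "u = L1_class M f" using assms by (auto simp: L1_def)
  show "integrable M (L1_rep u)" using L1_rep_class(1)[OF f(1)] f(2) by simp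
  show "L1_class M (L1_rep u) = u"
    using L1_class_eq_iff[OF L1_rep_class(1)[OF f(1)] f(1)] L1_rep_class(2)[OF f(1)] f(2) by simp
qed

lemma L1_add_class:
  assumes "integrable M f" "integrable M g"
  shows "L1_add M (L1_class M f) (L1_class M g) = L1_class M (\<lambda>x. f x + g x)"
proof -
  note f = L1_rep_class[OF assms(1)] and g = L1_rep_class[OF assms(2)]
  have "AE x in M. L1_rep (L1_class M f) x + L1_rep (L1_class M g) x = f x + g x"
    using f(2) g(2) by eventually_elim simp
  then show ?thesis unfolding L1_add_def using f(1) g(1) assms
    by (subst L1_class_eq_iff) auto
qed

lemma L1_scale_class:
  assumes "integrable M f"
  shows "L1_scale M c (L1_class M f) = L1_class M (\<lambda>x. c * f x)"
proof -
  note f = L1_rep_class[OF assms]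
  have "AE x in M. c * L1_rep (L1_class M f) x = c * f x"
    using f(2) by eventually_elim simp
  then show ?thesis unfolding L1_scale_def using f(1) assms
    by (subst L1_class_eq_iff) auto
qed

lemma L1_norm_class:
  assumes "integrable M f"
  shows "L1_norm M (L1_class M f) = (LINT x|M. \<bar>f x\<bar>)"
proof -
  note f = L1_rep_class[OF assms]
  have "AE x in M. \<bar>L1_rep (L1_class M f) x\<bar> = \<bar>f x\<bar>"
    using f(2) by eventually_elim simp
  then show ?thesis unfolding L1_norm_def using f(1) assms
    by (intro integral_cong_AE) auto
qed

lemma L1_dist_class:
  assumes "integrable M f" "integrable M g"
  shows "L1_dist M (L1_class M f) (L1_class M g) = (LINT x|M. \<bar>f x - g x\<bar>)"
proof -
  note f = L1_rep_class[OF assms(1)] and g = L1_rep_class[OF assms(2)]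
  have "AE x in M. \<bar>L1_rep (L1_class M f) x - L1_rep (L1_class M g) x\<bar> = \<bar>f x - g x\<bar>"
    using f(2) g(2) by eventually_elim simp
  then show ?thesis unfolding L1_dist_def using f(1) g(1) assms
    by (intro integral_cong_AE) auto
qed

lemma L1_cases:
  assumes "u \<in> L1 M"
  obtains f where "integrable M f" "u = L1_class M f"
  using assms by (auto simp: L1_def)

lemma L1_class_in_L1: "integrable M f \<Longrightarrow> L1_class M f \<in> L1 M"
  by (auto simp: L1_def)

lemma L1_dist_conv_norm:
  assumes "u \<in> L1 M" "v \<in> L1 M"
  shows "L1_dist M u v = L1_norm M (L1_add M u (L1_scale M (- 1) v))"
  using assms
  by (elim L1_cases) (simp add: L1_dist_class L1_scale_class L1_add_class L1_norm_class)

lemma L1_add_closed: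
  assumes "u \<in> L1 M" "v \<in> L1 M"
  shows "L1_add M u v \<in> L1 M"
  using assms by (elim L1_cases) (simp add: L1_add_class L1_class_in_L1)

lemma L1_dist_add_right:
  assumes "u \<in> L1 M" "v \<in> L1 M" "w \<in> L1 M"
  shows "L1_dist M (L1_add M u w) (L1_add M v w) = L1_dist M u v"
  using assms by (elim L1_cases) (simp add: L1_add_class L1_dist_class)

lemma L1_norm_conv_dist:
  assumes "u \<in> L1 M"
  shows "L1_norm M u = L1_dist M u (L1_zero M)"
  using assms by (elim L1_cases) (simp add: L1_zero_def L1_dist_class L1_norm_class)

lemma Metric_space_L1: "Metric_space (L1 M) (L1_dist M)"
proof
  show "0 \<le> L1_dist M u v" for u v by (simp add: L1_dist_def)
  show "L1_dist M u v = L1_dist M v u" for u v by (simp add: L1_dist_def abs_minus_commute)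
  show "L1_dist M u v = 0 \<longleftrightarrow> u = v" if "u \<in> L1 M" "v \<in> L1 M" for u v
    using that
    by (elim L1_cases)
      (simp add: L1_dist_class L1_class_eq_iff integral_nonneg_eq_0_iff_AE)
  show "L1_dist M u w \<le> L1_dist M u v + L1_dist M v w"
    if uvw: "u \<in> L1 M" "v \<in> L1 M" "w \<in> L1 M" for u v w
  proof -
    obtain f g h where *: "integrable M f" "integrable M g" "integrable M h"
      "u = L1_class M f" "v = L1_class M g" "w = L1_class M h"
      using uvw by (metis L1_cases)
    have "(LINT x|M. \<bar>f x - h x\<bar>) \<le> (LINT x|M. \<bar>f x - g x\<bar> + \<bar>g x - h x\<bar>)"
      using * by (intro integral_mono) auto
    also have "\<dots> = (LINT x|M. \<bar>f x - g x\<bar>) + (LINT x|M. \<bar>g x - h x\<bar>)"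
      using * by (intro Bochner_Integration.integral_add) auto
    finally show ?thesis using * by (simp add: L1_dist_class)
  qed
qed

section \<open>Affine actions on closed subspaces of \<open>L\<^sup>1\<close>\<close>

definition L1_closed_subspace :: "'a measure \<Rightarrow> ('a \<Rightarrow> real) set set \<Rightarrow> bool" where
  "L1_closed_subspace M E \<longleftrightarrow>
     E \<subseteq> L1 M \<and> L1_zero M \<in> E \<and>
     (\<forall>u\<in>E. \<forall>v\<in>E. L1_add M u v \<in> E) \<and> (\<forall>c. \<forall>u\<in>E. L1_scale M c u \<in> E) \<and>
     closedin (Metric_space.mtopology (L1 M) (L1_dist M)) E"

definition L1_bounded_operator ::
    "'a measure \<Rightarrow> ('a \<Rightarrow> real) set set \<Rightarrow> (('a \<Rightarrow> real) set \<Rightarrow> ('a \<Rightarrow> real) set) \<Rightarrow> bool" where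
  "L1_bounded_operator M E T \<longleftrightarrow>
     T ` E \<subseteq> E \<and>
     (\<forall>u\<in>E. \<forall>v\<in>E. T (L1_add M u v) = L1_add M (T u) (T v)) \<and>
     (\<forall>c. \<forall>u\<in>E. T (L1_scale M c u) = L1_scale M c (T u)) \<and>
     (\<exists>C. \<forall>u\<in>E. L1_norm M (T u) \<le> C * L1_norm M u)"

text \<open>
  For existence statements, the type \<open>real measure\<close> loses no generality. Its elements carry
  arbitrary sigma-algebras on arbitrary sets of reals, so up to isomorphism they are all measure
  spaces of cardinality at most that of the continuum. If a countable group acts on \<open>E\<close>, the
  closed linear span of the values of the cocycle is an invariant separable closed subspace, and
  every separable subspace of an \<open>L\<^sup>1\<close>-space embeds isometrically into \<open>L\<^sup>1[0,1]\<close>.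
\<close>

text \<open>Only the restrictions of the operators \<open>\<pi> s\<close> to the subspace \<open>E\<close> matter.\<close>

definition L1_affine_action ::
    "('g, 'm) monoid_scheme \<Rightarrow> 'a measure \<Rightarrow> ('a \<Rightarrow> real) set set \<Rightarrow>
     ('g \<Rightarrow> ('a \<Rightarrow> real) set \<Rightarrow> ('a \<Rightarrow> real) set) \<Rightarrow> ('g \<Rightarrow> ('a \<Rightarrow> real) set) \<Rightarrow> bool" where
  "L1_affine_action G M E \<pi> b \<longleftrightarrow>
     (\<forall>s\<in>carrier G. L1_bounded_operator M E (\<pi> s)) \<and>
     (\<forall>v\<in>E. \<pi> \<one>\<^bsub>G\<^esub> v = v) \<and>
     (\<forall>s\<in>carrier G. \<forall>t\<in>carrier G. \<forall>v\<in>E. \<pi> (s \<otimes>\<^bsub>G\<^esub> t) v = \<pi> s (\<pi> t v)) \<and>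
     (\<forall>s\<in>carrier G. b s \<in> E) \<and>
     (\<forall>s\<in>carrier G. \<forall>t\<in>carrier G. b (s \<otimes>\<^bsub>G\<^esub> t) = L1_add M (\<pi> s (b t)) (b s))"

definition L1_affine_map ::
    "'a measure \<Rightarrow> ('g \<Rightarrow> ('a \<Rightarrow> real) set \<Rightarrow> ('a \<Rightarrow> real) set) \<Rightarrow> ('g \<Rightarrow> ('a \<Rightarrow> real) set) \<Rightarrow>
     'g \<Rightarrow> ('a \<Rightarrow> real) set \<Rightarrow> ('a \<Rightarrow> real) set" where
  "L1_affine_map M \<pi> b s v = L1_add M (\<pi> s v) (b s)"

definition L1_uniformly_lipschitz ::
    "('g, 'm) monoid_scheme \<Rightarrow> 'a measure \<Rightarrow> ('a \<Rightarrow> real) set set \<Rightarrow>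
     ('g \<Rightarrow> ('a \<Rightarrow> real) set \<Rightarrow> ('a \<Rightarrow> real) set) \<Rightarrow> ('g \<Rightarrow> ('a \<Rightarrow> real) set) \<Rightarrow> bool" where
  "L1_uniformly_lipschitz G M E \<pi> b \<longleftrightarrow>
     (\<exists>L. \<forall>s\<in>carrier G. \<forall>v\<in>E. \<forall>w\<in>E.
        L1_dist M (L1_affine_map M \<pi> b s v) (L1_affine_map M \<pi> b s w) \<le> L * L1_dist M v w)"

definition L1_unbounded_orbits ::
    "('g, 'm) monoid_scheme \<Rightarrow> 'a measure \<Rightarrow> ('a \<Rightarrow> real) set set \<Rightarrow>
     ('g \<Rightarrow> ('a \<Rightarrow> real) set \<Rightarrow> ('a \<Rightarrow> real) set) \<Rightarrow> ('g \<Rightarrow> ('a \<Rightarrow> real) set) \<Rightarrow> bool" where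
  "L1_unbounded_orbits G M E \<pi> b \<longleftrightarrow>
     (\<forall>v\<in>E. \<not> Metric_space.mbounded (L1 M) (L1_dist M) (orbit G (L1_affine_map M \<pi> b) v))"

text \<open>
  The usual reformulations: the action is uniformly Lipschitz iff the linear part is uniformly
  bounded, and then its orbits are unbounded iff the cocycle is unbounded.
\<close>

lemma L1_uniformly_lipschitz_iff:
  assumes E: "L1_closed_subspace M E" and act: "L1_affine_action G M E \<pi> b"
  shows "L1_uniformly_lipschitz G M E \<pi> b \<longleftrightarrow>
    (\<exists>C. \<forall>s\<in>carrier G. \<forall>v\<in>E. L1_norm M (\<pi> s v) \<le> C * L1_norm M v)"
proof -
  have sub: "E \<subseteq> L1 M" and zero: "L1_zero M \<in> E"
    and addE: "\<And>u v. u \<in> E \<Longrightarrow> v \<in> E \<Longrightarrow> L1_add M u v \<in> E"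
    and scaleE: "\<And>c u. u \<in> E \<Longrightarrow> L1_scale M c u \<in> E"
    using E by (auto simp: L1_closed_subspace_def)
  have op: "\<pi> s v \<in> E" "b s \<in> E" if "s \<in> carrier G" "v \<in> E" for s v
    using act that by (auto simp: L1_affine_action_def L1_bounded_operator_def image_subset_iff)
  have "L1_scale M 0 (L1_zero M) = L1_zero M" "\<And>u. u \<in> L1 M \<Longrightarrow> L1_scale M 0 u = L1_zero M"
    by (auto simp: L1_zero_def L1_scale_class elim: L1_cases)
  then have pi0: "\<pi> s (L1_zero M) = L1_zero M" if "s \<in> carrier G" for s
    using act that zero op[OF that zero] sub
    unfolding L1_affine_action_def L1_bounded_operator_def by (metis subsetD)
  have dist: "L1_dist M (L1_affine_map M \<pi> b s v) (L1_affine_map M \<pi> b s w)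
      = L1_dist M (\<pi> s v) (\<pi> s w)" if "s \<in> carrier G" "v \<in> E" "w \<in> E" for s v w
    using op[OF that(1,2)] op[OF that(1,3)] sub
    by (auto simp: L1_affine_map_def intro!: L1_dist_add_right)
  show ?thesis
  proof
    assume "L1_uniformly_lipschitz G M E \<pi> b"
    then obtain L where L: "\<And>s v w. s \<in> carrier G \<Longrightarrow> v \<in> E \<Longrightarrow> w \<in> E \<Longrightarrow>
        L1_dist M (\<pi> s v) (\<pi> s w) \<le> L * L1_dist M v w"
      unfolding L1_uniformly_lipschitz_def using dist by metis
    have "L1_norm M (\<pi> s v) \<le> L * L1_norm M v" if "s \<in> carrier G" "v \<in> E" for s v
      using L[OF that zero] pi0[OF that(1)] L1_norm_conv_dist op[OF that] that sub
      by (metis subsetD)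
    then show "\<exists>C. \<forall>s\<in>carrier G. \<forall>v\<in>E. L1_norm M (\<pi> s v) \<le> C * L1_norm M v" by blast
  next
    assume "\<exists>C. \<forall>s\<in>carrier G. \<forall>v\<in>E. L1_norm M (\<pi> s v) \<le> C * L1_norm M v"
    then obtain C where C: "\<And>s v. s \<in> carrier G \<Longrightarrow> v \<in> E \<Longrightarrow>
        L1_norm M (\<pi> s v) \<le> C * L1_norm M v" by blast
    have "L1_dist M (\<pi> s v) (\<pi> s w) \<le> C * L1_dist M v w"
      if "s \<in> carrier G" "v \<in> E" "w \<in> E" for s v w
    proof -
      let ?u = "L1_add M v (L1_scale M (- 1) w)"
      have "\<pi> s ?u = L1_add M (\<pi> s v) (L1_scale M (- 1) (\<pi> s w))"
        using act that scaleE by (simp add: L1_affine_action_def L1_bounded_operator_def)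
      moreover have "L1_norm M (\<pi> s ?u) \<le> C * L1_norm M ?u"
        using that addE scaleE by (intro C) auto
      moreover have "v \<in> L1 M" "w \<in> L1 M" "\<pi> s v \<in> L1 M" "\<pi> s w \<in> L1 M"
        using that op sub by blast+
      ultimately show ?thesis by (simp add: L1_dist_conv_norm)
    qed
    then show "L1_uniformly_lipschitz G M E \<pi> b"
      unfolding L1_uniformly_lipschitz_def using dist by auto
  qed
qed

lemma L1_unbounded_orbits_iff:
  assumes E: "L1_closed_subspace M E" and act: "L1_affine_action G M E \<pi> b"
    and lip: "L1_uniformly_lipschitz G M E \<pi> b"
  shows "L1_unbounded_orbits G M E \<pi> b \<longleftrightarrow> \<not> bdd_above ((\<lambda>s. L1_norm M (b s)) ` carrier G)"
proof -
  interpret L: Metric_space "L1 M" "L1_dist M" by (rule Metric_space_L1)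
  have sub: "E \<subseteq> L1 M" and zero: "L1_zero M \<in> E"
    using E by (auto simp: L1_closed_subspace_def)
  have op: "\<pi> s v \<in> L1 M" "b s \<in> L1 M" if "s \<in> carrier G" "v \<in> E" for s v
    using act that sub by (auto simp: L1_affine_action_def L1_bounded_operator_def image_subset_iff)
  obtain C where C: "\<And>s v. s \<in> carrier G \<Longrightarrow> v \<in> E \<Longrightarrow> L1_norm M (\<pi> s v) \<le> C * L1_norm M v"
    using lip L1_uniformly_lipschitz_iff[OF E act] by blast
  have dist: "L1_dist M (L1_affine_map M \<pi> b s v) (b s) = L1_norm M (\<pi> s v)"
    if "s \<in> carrier G" "v \<in> E" for s v
    using op[OF that] unfolding L1_affine_map_def
    by (elim L1_cases) (simp add: L1_add_class L1_dist_class L1_norm_class)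
  have bdd: "bdd_above ((\<lambda>s. L1_norm M (b s)) ` carrier G) \<longleftrightarrow>
      L.mbounded (orbit G (L1_affine_map M \<pi> b) v)" if v: "v \<in> E" for v
  proof
    assume "bdd_above ((\<lambda>s. L1_norm M (b s)) ` carrier G)"
    then obtain B where B: "\<And>s. s \<in> carrier G \<Longrightarrow> L1_norm M (b s) \<le> B"
      by (auto simp: bdd_above_def)
    have "L1_affine_map M \<pi> b s v \<in> L.mcball (L1_zero M) (C * L1_norm M v + B)"
      if s: "s \<in> carrier G" for s
    proof -
      have in1: "L1_affine_map M \<pi> b s v \<in> L1 M"
        using op[OF s v] by (simp add: L1_affine_map_def L1_add_closed)
      have z: "L1_zero M \<in> L1 M" using zero sub by blast
      have "L1_dist M (L1_affine_map M \<pi> b s v) (L1_zero M)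
          \<le> L1_dist M (L1_affine_map M \<pi> b s v) (b s) + L1_dist M (b s) (L1_zero M)"
        using in1 z op[OF s v] by (intro L.triangle)
      also have "\<dots> \<le> C * L1_norm M v + B"
        using dist[OF s v] C[OF s v] B[OF s] L1_norm_conv_dist[OF op(2)[OF s v]] by simp
      finally show ?thesis using in1 z by (simp add: L.commute)
    qed
    then show "L.mbounded (orbit G (L1_affine_map M \<pi> b) v)"
      unfolding L.mbounded_def orbit_def by blast
  next
    assume "L.mbounded (orbit G (L1_affine_map M \<pi> b) v)"
    then obtain x B where x: "orbit G (L1_affine_map M \<pi> b) v \<subseteq> L.mcball x B"
      by (auto simp: L.mbounded_def)
    have "L1_norm M (b s) \<le> C * L1_norm M v + B + L1_dist M x (L1_zero M)"
      if s: "s \<in> carrier G" for s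
    proof -
      let ?y = "L1_affine_map M \<pi> b s v"
      have "?y \<in> L.mcball x B" using x s by (auto simp: orbit_def)
      then have y: "x \<in> L1 M" "?y \<in> L1 M" "L1_dist M x ?y \<le> B" by auto
      have z: "L1_zero M \<in> L1 M" using zero sub by blast
      have "L1_dist M (b s) (L1_zero M) \<le> L1_dist M (b s) ?y + L1_dist M ?y (L1_zero M)"
        using y z op[OF s v] by (intro L.triangle)
      also have "L1_dist M ?y (L1_zero M) \<le> L1_dist M ?y x + L1_dist M x (L1_zero M)"
        using y z by (intro L.triangle)
      finally show ?thesis
        using dist[OF s v] C[OF s v] L1_norm_conv_dist[OF op(2)[OF s v]] y(3)
          L.commute[of "b s" ?y] L.commute[of x ?y] by simp
    qed
    then show "bdd_above ((\<lambda>s. L1_norm M (b s)) ` carrier G)"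
      by (intro bdd_aboveI2)
  qed
  then show ?thesis unfolding L1_unbounded_orbits_def using zero by (auto simp flip: bdd)
qed

end

theory Submission
  imports Defs "HOL-Probability.Probability"
begin

text \<open>
  Suppose first that \<open>F : \<Gamma> \<rightarrow> \<real>\<close> is an unbounded quasimorphism, with
  \<open>\<bar>F (s t) - F s - F t\<bar> \<le> K\<close>. On the finitely supported functions \<open>v\<close> on \<open>\<Gamma>\<close> of total mass
  zero, translation by \<open>s\<close> changes the functional \<open>v \<mapsto> \<Sum>t. v t * F t\<close> by at most \<open>K\<close> times
  the \<open>\<ell>\<^sup>1\<close>-norm of \<open>v\<close>. Adding the absolute value of this functional to the \<open>\<ell>\<^sup>1\<close>-norm
  therefore gives a norm for which all translations are uniformly bounded, which embeds into
  an \<open>L\<^sup>1\<close>-space, and in which \<open>\<delta>\<^sub>s - \<delta>\<^sub>1\<close>, a cocycle, has norm at least \<open>\<bar>F s\<bar>\<close>. The same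
  works when \<open>F\<close> takes values in \<open>L\<^sup>1(P)\<close> for a probability space \<open>P\<close> on which \<open>\<Gamma>\<close> acts, and
  \<open>F\<close> is an unbounded quasi-cocycle. The space is then
  \<open>{(v, f) \<in> \<ell>\<^sup>1(\<Gamma>) \<oplus> L\<^sup>1(P). \<Sum>t. v t = 0}\<close>; this is \<open>L1_action_of_quasi_cocycle\<close>.

  The quasi-cocycle comes from asymmetric metrics. In a hyperbolic space \<open>S\<close>, fix a family
  of long directed segments, the shortcuts, and let passing through one of them in its
  direction be cheaper by a constant \<open>C\<close> than its length. The resulting distance \<open>D\<close> is not
  symmetric. If the shortcuts are long compared with \<open>C\<close> and the hyperbolicity constant,
  nearly optimal routes are local geodesics on a large scale, hence pass near every point of
  a geodesic, and \<open>D\<close> is additive along geodesics up to a constant. Every triangle of \<open>S\<close>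
  has a centre near its three sides, so \<open>D x y - D y x\<close> is additive around triangles up to a
  constant (\<open>asymmetry_quasi_additive\<close>). For a family of shortcuts invariant under \<open>\<Gamma>\<close> this
  means that \<open>s \<mapsto> D x\<^sub>0 (s x\<^sub>0) - D (s x\<^sub>0) x\<^sub>0\<close> is a quasimorphism.

  Two limit points suffice for a loxodromic element \<open>w\<close> (\<open>exists_loxodromic\<close>). The
  translates of the segment from \<open>x\<^sub>0\<close> to \<open>w\<^sup>k x\<^sub>0\<close> are natural shortcuts, and the powers of
  \<open>w\<close> then have large absolute values of \<open>D x\<^sub>0 (w\<^sup>n x\<^sub>0) - D (w\<^sup>n x\<^sub>0) x\<^sub>0\<close> unless some
  translates run along the axis of \<open>w\<close> in the opposite direction. This does happen, for
  instance in the infinite dihedral group, and it is the reason for working with random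
  orientations: the translates are grouped into classes of parallel translates with the same
  direction (\<open>axis_class\<close>), and each class is switched on or off by an independent fair
  coin. By acylindricity (\<open>reversed_segment_reverses_axis\<close>), the long translates that run
  backwards along the axis of \<open>w\<close> form at most one class. So with probability at least \<open>1/4\<close>
  the forward class is on and the backward class is off, and then
  \<open>D x\<^sub>0 (w\<^sup>n x\<^sub>0) - D (w\<^sup>n x\<^sub>0) x\<^sub>0\<close> tends to \<open>-\<infinity>\<close> linearly along multiples of \<open>k\<close>
  (\<open>drift_oriented_axis\<close>). As \<open>\<Gamma>\<close> permutes the coins, the result is an unbounded
  quasi-cocycle with values in the \<open>L\<^sup>1\<close>-space of the coin tosses.
\<close>

section \<open>Affine actions from bounded operators on functions\<close>

text \<open>
  Passing to classes modulo null sets once and for all: operators on functions descend to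
  classes because a bounded linear operator sends a function with vanishing integral of its
  absolute value to another such function.
\<close>
lemma L1_action_from_functions:
  fixes G :: "('g, 'm) monoid_scheme" and M :: "'c measure" and H :: "('c \<Rightarrow> real) set"
    and T :: "'g \<Rightarrow> ('c \<Rightarrow> real) \<Rightarrow> 'c \<Rightarrow> real" and \<beta> :: "'g \<Rightarrow> 'c \<Rightarrow> real"
  assumes G: "group G"
    and H_int: "\<And>f. f \<in> H \<Longrightarrow> integrable M f"
    and H_zero: "(\<lambda>_. 0) \<in> H"
    and H_add: "\<And>f g. f \<in> H \<Longrightarrow> g \<in> H \<Longrightarrow> (\<lambda>x. f x + g x) \<in> H"
    and H_scale: "\<And>c f. f \<in> H \<Longrightarrow> (\<lambda>x. c * f x) \<in> H"
    and H_closed: "\<And>f. integrable M f \<Longrightarrow> (\<And>e. e > 0 \<Longrightarrow> \<exists>h\<in>H. (LINT x|M. \<bar>f x - h x\<bar>) < e) \<Longrightarrow> f \<in> H"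
    and T_in: "\<And>s f. s \<in> carrier G \<Longrightarrow> f \<in> H \<Longrightarrow> T s f \<in> H"
    and T_add: "\<And>s f g x. s \<in> carrier G \<Longrightarrow> f \<in> H \<Longrightarrow> g \<in> H \<Longrightarrow> x \<in> space M \<Longrightarrow>
      T s (\<lambda>x. f x + g x) x = T s f x + T s g x"
    and T_scale: "\<And>s c f x. s \<in> carrier G \<Longrightarrow> f \<in> H \<Longrightarrow> x \<in> space M \<Longrightarrow>
      T s (\<lambda>x. c * f x) x = c * T s f x"
    and T_bound: "\<And>s f. s \<in> carrier G \<Longrightarrow> f \<in> H \<Longrightarrow> (LINT x|M. \<bar>T s f x\<bar>) \<le> C * (LINT x|M. \<bar>f x\<bar>)"
    and T_one: "\<And>f x. f \<in> H \<Longrightarrow> x \<in> space M \<Longrightarrow> T \<one>\<^bsub>G\<^esub> f x = f x"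
    and T_mult: "\<And>s t f x. s \<in> carrier G \<Longrightarrow> t \<in> carrier G \<Longrightarrow> f \<in> H \<Longrightarrow> x \<in> space M \<Longrightarrow>
      T (s \<otimes>\<^bsub>G\<^esub> t) f x = T s (T t f) x"
    and b_in: "\<And>s. s \<in> carrier G \<Longrightarrow> \<beta> s \<in> H"
    and b_cocycle: "\<And>s t x. s \<in> carrier G \<Longrightarrow> t \<in> carrier G \<Longrightarrow> x \<in> space M \<Longrightarrow>
      \<beta> (s \<otimes>\<^bsub>G\<^esub> t) x = T s (\<beta> t) x + \<beta> s x"
    and unbounded: "\<And>B. \<exists>s\<in>carrier G. B < (LINT x|M. \<bar>\<beta> s x\<bar>)"
  shows "\<exists>E \<pi> b. L1_closed_subspace M E \<and> L1_affine_action G M E \<pi> b \<and>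
    L1_uniformly_lipschitz G M E \<pi> b \<and> L1_unbounded_orbits G M E \<pi> b"
proof -
  interpret group G by (rule G)
  define E where "E = L1_class M ` H"
  define \<pi> where "\<pi> s u = L1_class M (T s (L1_rep u))" for s u
  define b where "b s = L1_class M (\<beta> s)" for s
  note int [intro, simp] = H_int
  have class_eqI: "L1_class M f = L1_class M g"
    if "integrable M f" "integrable M g" "AE x in M. f x = g x" for f g
    using that by (simp add: L1_class_eq_iff)
  have H_AE: "f \<in> H" if "integrable M f" "h \<in> H" "AE x in M. f x = h x" for f h
  proof (rule H_closed[OF that(1)])
    fix e :: real assume "e > 0"
    moreover have "(LINT x|M. \<bar>f x - h x\<bar>) = 0"
      using that H_int[OF that(2)] by (subst integral_nonneg_eq_0_iff_AE) auto
    ultimately show "\<exists>h\<in>H. (LINT x|M. \<bar>f x - h x\<bar>) < e" using that(2) by (intro bexI[of _ h]) auto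
  qed
  have T_AE: "AE x in M. T s f x = T s h x"
    if s: "s \<in> carrier G" and fh: "f \<in> H" "h \<in> H" "AE x in M. f x = h x" for s f h
  proof -
    define g where "g x = f x + (- 1) * h x" for x
    have g: "g \<in> H" unfolding g_def using fh by (intro H_add H_scale)
    have Tg: "T s g x = T s f x - T s h x" if "x \<in> space M" for x
      using T_add[OF s fh(1) H_scale[OF fh(2), of "- 1"] that] T_scale[OF s fh(2) that, of "- 1"]
      unfolding g_def by simp
    have "(LINT x|M. \<bar>g x\<bar>) = 0"
      using fh H_int[OF g] by (subst integral_nonneg_eq_0_iff_AE) (auto simp: g_def)
    then have "(LINT x|M. \<bar>T s g x\<bar>) \<le> 0" using T_bound[OF s g] by simp
    moreover have "0 \<le> (LINT x|M. \<bar>T s g x\<bar>)" by simp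
    ultimately have "(LINT x|M. \<bar>T s g x\<bar>) = 0" by linarith
    then have "AE x in M. \<bar>T s g x\<bar> = 0"
      using H_int[OF T_in[OF s g]] by (subst (asm) integral_nonneg_eq_0_iff_AE) auto
    then show ?thesis
      using AE_space by eventually_elim (simp add: Tg)
  qed
  have rep: "L1_rep (L1_class M f) \<in> H" if "f \<in> H" for f
    using H_AE[OF L1_rep_class(1) that L1_rep_class(2)] that by simp
  have pi: "\<pi> s (L1_class M f) = L1_class M (T s f)" if "s \<in> carrier G" "f \<in> H" for s f
    unfolding \<pi>_def
    by (rule class_eqI[OF _ _ T_AE[OF that(1) rep[OF that(2)] that(2) L1_rep_class(2)[OF H_int[OF that(2)]]]])
      (use that rep T_in in auto)
  have cong: "L1_class M f = L1_class M g"
    if "integrable M f" "integrable M g" "\<And>x. x \<in> space M \<Longrightarrow> f x = g x" for f g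
    using that by (intro class_eqI AE_I2) auto
  have E_L1: "E \<subseteq> L1 M" by (auto simp: E_def L1_class_in_L1)
  have closed: "closedin (Metric_space.mtopology (L1 M) (L1_dist M)) E"
  proof -
    interpret L: Metric_space "L1 M" "L1_dist M" by (rule Metric_space_L1)
    have "\<exists>r>0. disjnt E (L.mball u r)" if u: "u \<in> L1 M - E" for u
    proof (rule ccontr)
      assume no: "\<not> ?thesis"
      obtain f where f: "integrable M f" "u = L1_class M f" using u by (auto elim: L1_cases)
      have "f \<in> H"
      proof (rule H_closed[OF f(1)])
        fix e :: real assume "e > 0"
        then have "E \<inter> L.mball u e \<noteq> {}" using no by (simp add: disjnt_def)
        then obtain v where v: "v \<in> E" "v \<in> L.mball u e" by blast
        then obtain h where h: "h \<in> H" "v = L1_class M h" by (auto simp: E_def)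
        have "(LINT x|M. \<bar>f x - h x\<bar>) = L1_dist M u v" using f h by (simp add: L1_dist_class)
        then show "\<exists>h\<in>H. (LINT x|M. \<bar>f x - h x\<bar>) < e" using v h by (intro bexI[of _ h]) auto
      qed
      then show False using u f by (auto simp: E_def)
    qed
    then show ?thesis using E_L1 unfolding L.closedin_metric by blast
  qed
  have sub: "L1_closed_subspace M E"
    unfolding L1_closed_subspace_def
  proof (intro conjI ballI allI closed E_L1)
    show "L1_zero M \<in> E" using H_zero by (simp add: E_def L1_zero_def)
    show "L1_add M u v \<in> E" if "u \<in> E" "v \<in> E" for u v
      using that H_add by (auto simp: E_def L1_add_class)
    show "L1_scale M c u \<in> E" if "u \<in> E" for c u
      using that H_scale by (auto simp: E_def L1_scale_class)
  qed
  have norm: "L1_norm M (\<pi> s u) \<le> C * L1_norm M u" if "s \<in> carrier G" "u \<in> E" for s u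
    using that T_in T_bound by (auto simp: E_def pi L1_norm_class)
  have act: "L1_affine_action G M E \<pi> b"
    unfolding L1_affine_action_def L1_bounded_operator_def
  proof (intro conjI ballI allI)
    show "\<pi> s ` E \<subseteq> E" if "s \<in> carrier G" for s
      using that T_in by (auto simp: E_def pi)
    show "\<pi> s (L1_add M u v) = L1_add M (\<pi> s u) (\<pi> s v)" if su: "s \<in> carrier G" "u \<in> E" "v \<in> E" for s u v
    proof -
      obtain f g where fg: "f \<in> H" "g \<in> H" "u = L1_class M f" "v = L1_class M g"
        using su by (auto simp: E_def)
      show ?thesis
        using su(1) fg H_add[OF fg(1,2)] T_in by (simp add: pi L1_add_class) (intro cong; simp add: T_add)
    qed
    show "\<pi> s (L1_scale M c u) = L1_scale M c (\<pi> s u)" if su: "s \<in> carrier G" "u \<in> E" for s c u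
    proof -
      obtain f where f: "f \<in> H" "u = L1_class M f" using su by (auto simp: E_def)
      show ?thesis
        using su(1) f H_scale[OF f(1)] T_in by (simp add: pi L1_scale_class) (intro cong; simp add: T_scale)
    qed
    show "\<exists>C. \<forall>u\<in>E. L1_norm M (\<pi> s u) \<le> C * L1_norm M u" if "s \<in> carrier G" for s
      using norm that by blast
    show "\<pi> \<one>\<^bsub>G\<^esub> v = v" if v: "v \<in> E" for v
    proof -
      obtain f where f: "f \<in> H" "v = L1_class M f" using v by (auto simp: E_def)
      show ?thesis using f T_in by (simp add: pi) (intro cong; simp add: T_one)
    qed
    show "\<pi> (s \<otimes>\<^bsub>G\<^esub> t) v = \<pi> s (\<pi> t v)" if st: "s \<in> carrier G" "t \<in> carrier G" "v \<in> E" for s t v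
    proof -
      obtain f where f: "f \<in> H" "v = L1_class M f" using st by (auto simp: E_def)
      show ?thesis using st(1,2) f T_in by (simp add: pi) (intro cong; simp add: T_mult)
    qed
    show "b s \<in> E" if "s \<in> carrier G" for s using that b_in by (auto simp: E_def b_def)
    show "b (s \<otimes>\<^bsub>G\<^esub> t) = L1_add M (\<pi> s (b t)) (b s)" if "s \<in> carrier G" "t \<in> carrier G" for s t
      using that b_in T_in by (simp add: b_def pi L1_add_class) (intro cong; simp add: b_cocycle)
  qed
  have lip: "L1_uniformly_lipschitz G M E \<pi> b"
    using norm by (subst L1_uniformly_lipschitz_iff[OF sub act]) blast
  have "\<not> bdd_above ((\<lambda>s. L1_norm M (b s)) ` carrier G)"
  proof
    assume "bdd_above ((\<lambda>s. L1_norm M (b s)) ` carrier G)"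
    then obtain B where "\<And>s. s \<in> carrier G \<Longrightarrow> L1_norm M (b s) \<le> B" by (auto simp: bdd_above_def)
    then have "(LINT x|M. \<bar>\<beta> s x\<bar>) \<le> B" if "s \<in> carrier G" for s
      using that b_in by (simp add: b_def L1_norm_class)
    then show False using unbounded[of B] by (meson not_less)
  qed
  then show ?thesis
    using sub act lip L1_unbounded_orbits_iff[OF sub act lip]
    by (intro exI[of _ E] exI[of _ \<pi>] exI[of _ b]) simp
qed

section \<open>Disjoint unions of measure spaces\<close>

text \<open>
  The disjoint union of two measure spaces, realised inside a third type by the maps \<open>e\<close> and
  \<open>j\<close>, which should be injective and have disjoint images.
\<close>
definition glued_measure :: "('a \<Rightarrow> 'c) \<Rightarrow> 'a measure \<Rightarrow> ('b \<Rightarrow> 'c) \<Rightarrow> 'b measure \<Rightarrow> 'c measure" where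
  "glued_measure e A j B = measure_of (e ` space A \<union> j ` space B)
     {X. X \<subseteq> e ` space A \<union> j ` space B \<and> e -` X \<inter> space A \<in> sets A \<and> j -` X \<inter> space B \<in> sets B}
     (\<lambda>X. emeasure A (e -` X \<inter> space A) + emeasure B (j -` X \<inter> space B))"

lemma glued_sigma_algebra:
  "sigma_algebra (e ` space A \<union> j ` space B)
     {X. X \<subseteq> e ` space A \<union> j ` space B \<and> e -` X \<inter> space A \<in> sets A \<and> j -` X \<inter> space B \<in> sets B}"
    (is "sigma_algebra ?S ?F")
proof (rule sigma_algebra_iff2[THEN iffD2], intro conjI ballI allI impI)
  show "?F \<subseteq> Pow ?S" by auto
  show "{} \<in> ?F" by simp
  show "?S - X \<in> ?F" if "X \<in> ?F" for X
  proof -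
    have "e -` (?S - X) \<inter> space A = space A - e -` X \<inter> space A"
      "j -` (?S - X) \<inter> space B = space B - j -` X \<inter> space B" by auto
    then show ?thesis using that by auto
  qed
  show "(\<Union>i. X i) \<in> ?F" if "range X \<subseteq> ?F" for X :: "nat \<Rightarrow> _"
  proof -
    have "e -` (\<Union>i. X i) \<inter> space A = (\<Union>i. e -` X i \<inter> space A)"
      "j -` (\<Union>i. X i) \<inter> space B = (\<Union>i. j -` X i \<inter> space B)" by auto
    moreover have "(\<Union>i. e -` X i \<inter> space A) \<in> sets A" "(\<Union>i. j -` X i \<inter> space B) \<in> sets B"
      "(\<Union>i. X i) \<subseteq> ?S"
      using that by (intro sets.countable_UN UN_least; blast)+
    ultimately show ?thesis by simp
  qed
qed

lemma space_glued [simp]: "space (glued_measure e A j B) = e ` space A \<union> j ` space B"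
  unfolding glued_measure_def by (rule space_measure_of) auto

lemma sets_glued:
  "sets (glued_measure e A j B) =
    {X. X \<subseteq> e ` space A \<union> j ` space B \<and> e -` X \<inter> space A \<in> sets A \<and> j -` X \<inter> space B \<in> sets B}"
  unfolding glued_measure_def
  by (subst sets_measure_of) (auto intro!: sigma_algebra.sigma_sets_eq glued_sigma_algebra)

lemma emeasure_glued:
  assumes "X \<in> sets (glued_measure e A j B)"
  shows "emeasure (glued_measure e A j B) X = emeasure A (e -` X \<inter> space A) + emeasure B (j -` X \<inter> space B)"
proof (rule emeasure_measure_of[OF glued_measure_def _ _ _ assms])
  show "positive (sets (glued_measure e A j B))
      (\<lambda>X. emeasure A (e -` X \<inter> space A) + emeasure B (j -` X \<inter> space B))"
    by (simp add: positive_def)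
  show "countably_additive (sets (glued_measure e A j B))
      (\<lambda>X. emeasure A (e -` X \<inter> space A) + emeasure B (j -` X \<inter> space B))"
  proof (rule countably_additiveI)
    fix X :: "nat \<Rightarrow> 'a set"
    assume X: "range X \<subseteq> sets (glued_measure e A j B)" "disjoint_family X"
    have "(\<Sum>i. emeasure A (e -` X i \<inter> space A)) = emeasure A (\<Union>i. e -` X i \<inter> space A)"
      "(\<Sum>i. emeasure B (j -` X i \<inter> space B)) = emeasure B (\<Union>i. j -` X i \<inter> space B)"
    proof -
      have "range (\<lambda>i. e -` X i \<inter> space A) \<subseteq> sets A" "range (\<lambda>i. j -` X i \<inter> space B) \<subseteq> sets B"
        using X(1) by (auto simp: sets_glued)
      moreover have "disjoint_family (\<lambda>i. e -` X i \<inter> space A)" "disjoint_family (\<lambda>i. j -` X i \<inter> space B)"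
        using X(2) by (fastforce simp: disjoint_family_on_def)+
      ultimately show "(\<Sum>i. emeasure A (e -` X i \<inter> space A)) = emeasure A (\<Union>i. e -` X i \<inter> space A)"
        "(\<Sum>i. emeasure B (j -` X i \<inter> space B)) = emeasure B (\<Union>i. j -` X i \<inter> space B)"
        by (simp_all add: suminf_emeasure)
    qed
    moreover have "(\<Union>i. e -` X i \<inter> space A) = e -` (\<Union>i. X i) \<inter> space A"
      "(\<Union>i. j -` X i \<inter> space B) = j -` (\<Union>i. X i) \<inter> space B" by auto
    ultimately show "(\<Sum>i. emeasure A (e -` X i \<inter> space A) + emeasure B (j -` X i \<inter> space B)) =
        emeasure A (e -` (\<Union>i. X i) \<inter> space A) + emeasure B (j -` (\<Union>i. X i) \<inter> space B)"
      by (subst suminf_add[symmetric]) auto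
  qed
qed auto

lemma measurable_glued_left: "e \<in> A \<rightarrow>\<^sub>M glued_measure e A j B"
  by (rule measurableI) (auto simp: sets_glued)

lemma measurable_glued_right: "j \<in> B \<rightarrow>\<^sub>M glued_measure e A j B"
  by (rule measurableI) (auto simp: sets_glued)

lemma borel_measurable_glued:
  fixes u :: "'c \<Rightarrow> 'd::topological_space"
  shows "u \<in> borel_measurable (glued_measure e A j B) \<longleftrightarrow>
    (\<lambda>x. u (e x)) \<in> borel_measurable A \<and> (\<lambda>x. u (j x)) \<in> borel_measurable B" (is "?l \<longleftrightarrow> ?r")
proof
  show "?r" if "?l"
    using measurable_compose[OF measurable_glued_left that] measurable_compose[OF measurable_glued_right that]
    by simp
  assume r: "?r"
  show "?l"
  proof (rule measurableI)
    fix Y :: "'d set" assume Y: "Y \<in> sets borel"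
    have "e -` (u -` Y \<inter> (e ` space A \<union> j ` space B)) \<inter> space A = (\<lambda>x. u (e x)) -` Y \<inter> space A"
      "j -` (u -` Y \<inter> (e ` space A \<union> j ` space B)) \<inter> space B = (\<lambda>x. u (j x)) -` Y \<inter> space B" by auto
    then show "u -` Y \<inter> space (glued_measure e A j B) \<in> sets (glued_measure e A j B)"
      using measurable_sets[of "\<lambda>x. u (e x)" A borel Y] measurable_sets[of "\<lambda>x. u (j x)" B borel Y] r Y
      by (simp add: sets_glued)
  qed simp
qed

lemma nn_integral_glued:
  assumes "u \<in> borel_measurable (glued_measure e A j B)"
  shows "(\<integral>\<^sup>+x. u x \<partial>glued_measure e A j B) = (\<integral>\<^sup>+x. u (e x) \<partial>A) + (\<integral>\<^sup>+x. u (j x) \<partial>B)"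
  using assms
proof (induction rule: borel_measurable_induct)
  case (cong f g)
  have "(\<integral>\<^sup>+x. f x \<partial>glued_measure e A j B) = (\<integral>\<^sup>+x. g x \<partial>glued_measure e A j B)"
    "(\<integral>\<^sup>+x. f (e x) \<partial>A) = (\<integral>\<^sup>+x. g (e x) \<partial>A)" "(\<integral>\<^sup>+x. f (j x) \<partial>B) = (\<integral>\<^sup>+x. g (j x) \<partial>B)"
    using cong(3) by (auto intro!: nn_integral_cong)
  then show ?case using cong(4) by simp
next
  case (set X)
  have "(\<integral>\<^sup>+x. indicator X (e x) \<partial>A) = emeasure A (e -` X \<inter> space A)"
    "(\<integral>\<^sup>+x. indicator X (j x) \<partial>B) = emeasure B (j -` X \<inter> space B)"
    using set by (auto simp: sets_glued simp flip: nn_integral_indicator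
        intro!: nn_integral_cong split: split_indicator)
  then show ?case using set by (simp add: emeasure_glued)
next
  case (mult u c)
  have "(\<lambda>x. u (e x)) \<in> borel_measurable A" "(\<lambda>x. u (j x)) \<in> borel_measurable B"
    using mult(2) by (auto simp: borel_measurable_glued)
  then show ?case using mult by (simp add: nn_integral_cmult distrib_left)
next
  case (add u v)
  have "(\<lambda>x. u (e x)) \<in> borel_measurable A" "(\<lambda>x. u (j x)) \<in> borel_measurable B"
    "(\<lambda>x. v (e x)) \<in> borel_measurable A" "(\<lambda>x. v (j x)) \<in> borel_measurable B"
    using add(1,3) by (auto simp: borel_measurable_glued)
  then show ?case using add by (simp add: nn_integral_add add_ac)
next
  case (seq U)
  have meas: "(\<lambda>x. U i (e x)) \<in> borel_measurable A" "(\<lambda>x. U i (j x)) \<in> borel_measurable B" for i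
    using seq(1) by (auto simp: borel_measurable_glued)
  have inc: "incseq (\<lambda>i x. U i (e x))" "incseq (\<lambda>i x. U i (j x))"
    using \<open>incseq U\<close> by (auto simp: incseq_def le_fun_def)
  have incI: "incseq (\<lambda>i. \<integral>\<^sup>+x. U i (e x) \<partial>A)" "incseq (\<lambda>i. \<integral>\<^sup>+x. U i (j x) \<partial>B)"
    using \<open>incseq U\<close> by (auto simp: incseq_def le_fun_def intro!: nn_integral_mono)
  have "(\<integral>\<^sup>+x. (SUP i. U i x) \<partial>glued_measure e A j B) = (SUP i. \<integral>\<^sup>+x. U i x \<partial>glued_measure e A j B)"
    using seq by (intro nn_integral_monotone_convergence_SUP) auto
  also have "\<dots> = (SUP i. (\<integral>\<^sup>+x. U i (e x) \<partial>A) + (\<integral>\<^sup>+x. U i (j x) \<partial>B))"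
    using seq by simp
  also have "\<dots> = (SUP i. \<integral>\<^sup>+x. U i (e x) \<partial>A) + (SUP i. \<integral>\<^sup>+x. U i (j x) \<partial>B)"
    by (rule ennreal_SUP_add[OF incI])
  also have "\<dots> = (\<integral>\<^sup>+x. (SUP i. U i (e x)) \<partial>A) + (\<integral>\<^sup>+x. (SUP i. U i (j x)) \<partial>B)"
    using meas inc by (simp add: nn_integral_monotone_convergence_SUP)
  finally show ?case by (simp add: image_comp)
qed

lemma integrable_glued:
  fixes u :: "'c \<Rightarrow> real"
  shows "integrable (glued_measure e A j B) u \<longleftrightarrow>
    integrable A (\<lambda>x. u (e x)) \<and> integrable B (\<lambda>x. u (j x))"
proof (cases "u \<in> borel_measurable (glued_measure e A j B)")
  case True
  then have "(\<integral>\<^sup>+x. norm (u x) \<partial>glued_measure e A j B) =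
      (\<integral>\<^sup>+x. norm (u (e x)) \<partial>A) + (\<integral>\<^sup>+x. norm (u (j x)) \<partial>B)"
    by (intro nn_integral_glued) simp
  then show ?thesis using True by (auto simp: integrable_iff_bounded borel_measurable_glued)
next
  case False
  then show ?thesis by (auto simp: borel_measurable_glued dest: borel_measurable_integrable)
qed

lemma integral_glued_nonneg:
  fixes u :: "'c \<Rightarrow> real"
  assumes "integrable (glued_measure e A j B) u" "\<And>x. 0 \<le> u x"
  shows "(LINT x|glued_measure e A j B. u x) = (LINT x|A. u (e x)) + (LINT x|B. u (j x))"
proof -
  have int: "integrable A (\<lambda>x. u (e x))" "integrable B (\<lambda>x. u (j x))"
    using assms(1) by (auto simp: integrable_glued)
  have "ennreal (LINT x|glued_measure e A j B. u x) = (\<integral>\<^sup>+x. u x \<partial>glued_measure e A j B)"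
    using assms by (simp add: nn_integral_eq_integral)
  also have "\<dots> = (\<integral>\<^sup>+x. u (e x) \<partial>A) + (\<integral>\<^sup>+x. u (j x) \<partial>B)"
    using assms by (intro nn_integral_glued) auto
  also have "\<dots> = ennreal (LINT x|A. u (e x)) + ennreal (LINT x|B. u (j x))"
    using int assms by (simp add: nn_integral_eq_integral)
  also have "\<dots> = ennreal ((LINT x|A. u (e x)) + (LINT x|B. u (j x)))"
    using assms by simp
  finally show ?thesis using assms(2) by (subst (asm) ennreal_inj) (auto intro!: add_nonneg_nonneg integral_nonneg)
qed

definition glue_fun :: "('a \<Rightarrow> 'c) \<Rightarrow> 'a set \<Rightarrow> ('b \<Rightarrow> 'c) \<Rightarrow> 'b set \<Rightarrow> ('a \<Rightarrow> 'd) \<Rightarrow> ('b \<Rightarrow> 'd) \<Rightarrow> 'c \<Rightarrow> 'd" where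
  "glue_fun e X j Y f g z = (if z \<in> e ` X then f (inv_into X e z) else g (inv_into Y j z))"

lemma glue_fun_left: "inj_on e X \<Longrightarrow> x \<in> X \<Longrightarrow> glue_fun e X j Y f g (e x) = f x"
  by (simp add: glue_fun_def)

lemma glue_fun_right:
  "inj_on j Y \<Longrightarrow> e ` X \<inter> j ` Y = {} \<Longrightarrow> y \<in> Y \<Longrightarrow> glue_fun e X j Y f g (j y) = g y"
  by (auto simp: glue_fun_def)

section \<open>Affine actions from quasi-cocycles\<close>

lemma integrable_count_times_bounded:
  fixes a q :: "'a \<Rightarrow> real"
  assumes "integrable (count_space A) a" "\<And>t. t \<in> A \<Longrightarrow> \<bar>q t\<bar> \<le> K"
  shows "integrable (count_space A) (\<lambda>t. a t * q t)"
    and "\<bar>LINT t|count_space A. a t * q t\<bar> \<le> K * (LINT t|count_space A. \<bar>a t\<bar>)"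
proof -
  have le: "\<bar>a t * q t\<bar> \<le> K * \<bar>a t\<bar>" if "t \<in> A" for t
    using mult_right_mono[OF assms(2)[OF that], of "\<bar>a t\<bar>"] by (simp add: abs_mult mult.commute)
  have intK: "integrable (count_space A) (\<lambda>t. K * \<bar>a t\<bar>)" using assms(1) by simp
  show int: "integrable (count_space A) (\<lambda>t. a t * q t)"
    by (rule Bochner_Integration.integrable_bound[OF intK])
      (use le in \<open>auto simp: AE_count_space intro: order_trans[OF le]\<close>)
  have "\<bar>LINT t|count_space A. a t * q t\<bar> \<le> (LINT t|count_space A. \<bar>a t * q t\<bar>)"
    by (rule integral_abs_bound)
  also have "\<dots> \<le> (LINT t|count_space A. K * \<bar>a t\<bar>)"
    using int intK le by (intro integral_mono) auto
  finally show "\<bar>LINT t|count_space A. a t * q t\<bar> \<le> K * (LINT t|count_space A. \<bar>a t\<bar>)"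
    by simp
qed

text \<open>
  The elements of the space are pairs \<open>(v, f)\<close> with \<open>v \<in> \<ell>\<^sup>1(G)\<close> of total mass zero and
  \<open>f \<in> L\<^sup>1(P)\<close>. The defect \<open>q s t \<omega> = F (s t) \<omega> - F t ((inv s) \<omega>) - F s \<omega>\<close> enters the linear
  part, \<open>s (v, f) = (s v, s f + \<Sum>t. v t * q s t)\<close>, and bounds its norm by \<open>1 + K\<close>. This is
  what the regular representation becomes when \<open>v\<close> is replaced by \<open>(v, \<Sum>t. v t * F t)\<close>. The
  operators compose correctly because \<open>q (s t) r - q t r - q s (t r)\<close> does not depend on
  \<open>r\<close>, so that it is annihilated by functions of total mass zero. The cocycle is
  \<open>s \<mapsto> (\<delta>\<^sub>s - \<delta>\<^sub>1, F s)\<close>.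
\<close>
theorem L1_action_of_quasi_cocycle:
  fixes G :: "('g, 'm) monoid_scheme" and P :: "'w measure" and F :: "'g \<Rightarrow> 'w \<Rightarrow> real"
    and \<alpha> :: "'g \<Rightarrow> 'w \<Rightarrow> 'w" and j :: "'w \<Rightarrow> real"
  assumes G: "group G" and countable: "countable (carrier G)"
    and P: "prob_space P" and j: "inj_on j (space P)"
    and \<alpha>_meas: "\<And>s. s \<in> carrier G \<Longrightarrow> \<alpha> s \<in> P \<rightarrow>\<^sub>M P"
    and \<alpha>_pres: "\<And>s. s \<in> carrier G \<Longrightarrow> distr P P (\<alpha> s) = P"
    and \<alpha>_one: "\<And>\<omega>. \<omega> \<in> space P \<Longrightarrow> \<alpha> \<one>\<^bsub>G\<^esub> \<omega> = \<omega>"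
    and \<alpha>_mult: "\<And>s t \<omega>. s \<in> carrier G \<Longrightarrow> t \<in> carrier G \<Longrightarrow> \<omega> \<in> space P \<Longrightarrow>
      \<alpha> (s \<otimes>\<^bsub>G\<^esub> t) \<omega> = \<alpha> s (\<alpha> t \<omega>)"
    and F_int: "\<And>s. s \<in> carrier G \<Longrightarrow> integrable P (F s)"
    and F_one: "\<And>\<omega>. \<omega> \<in> space P \<Longrightarrow> F \<one>\<^bsub>G\<^esub> \<omega> = 0"
    and defect: "\<And>s t \<omega>. s \<in> carrier G \<Longrightarrow> t \<in> carrier G \<Longrightarrow> \<omega> \<in> space P \<Longrightarrow>
      \<bar>F (s \<otimes>\<^bsub>G\<^esub> t) \<omega> - F t (\<alpha> (inv\<^bsub>G\<^esub> s) \<omega>) - F s \<omega>\<bar> \<le> K"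
    and unbounded: "\<And>B. \<exists>s\<in>carrier G. B < (LINT \<omega>|P. \<bar>F s \<omega>\<bar>)"
  shows "\<exists>(M :: real measure) E \<pi> b.
    L1_closed_subspace M E \<and> L1_affine_action G M E \<pi> b \<and>
    L1_uniformly_lipschitz G M E \<pi> b \<and> L1_unbounded_orbits G M E \<pi> b"
proof -
  interpret group G by (rule G)
  interpret P: prob_space P by (rule P)
  let ?\<Gamma> = "carrier G"
  let ?A = "count_space ?\<Gamma>"
  \<comment> \<open>Atoms at the nonpositive integers carry \<open>\<ell>\<^sup>1(G)\<close>, positive numbers carry the points of \<open>P\<close>.\<close>
  define i where "i \<omega> = exp (j \<omega>)" for \<omega>
  define e where "e s = - real (to_nat_on ?\<Gamma> s)" for s
  have inj: "inj_on e ?\<Gamma>" "inj_on i (space P)"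
    using inj_on_to_nat_on[OF countable] j by (auto simp: inj_on_def e_def i_def)
  have "e s \<noteq> i \<omega>" for s \<omega> using exp_gt_zero[of "j \<omega>"] unfolding e_def i_def by linarith
  then have disj: "e ` ?\<Gamma> \<inter> i ` space P = {}" by auto
  define M where "M = glued_measure e ?A i P"
  have space_M: "space M = e ` ?\<Gamma> \<union> i ` space P" by (simp add: M_def)
  define glue where "glue = (glue_fun e ?\<Gamma> i (space P) :: ('g \<Rightarrow> real) \<Rightarrow> ('w \<Rightarrow> real) \<Rightarrow> real \<Rightarrow> real)"
  have gl [simp]: "glue f g (e s) = f s" if "s \<in> ?\<Gamma>" for f g s
    unfolding glue_def by (rule glue_fun_left[OF inj(1) that])
  have gr [simp]: "glue f g (i \<omega>) = g \<omega>" if "\<omega> \<in> space P" for f g \<omega>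
    unfolding glue_def by (rule glue_fun_right[OF inj(2) disj that])
  have int_M: "integrable M f \<longleftrightarrow> integrable ?A (\<lambda>s. f (e s)) \<and> integrable P (\<lambda>\<omega>. f (i \<omega>))" for f :: "real \<Rightarrow> real"
    unfolding M_def by (rule integrable_glued)
  have int_glue: "integrable M (glue f g) \<longleftrightarrow> integrable ?A f \<and> integrable P g" for f g
  proof -
    have "integrable ?A (\<lambda>s. glue f g (e s)) \<longleftrightarrow> integrable ?A f" "integrable P (\<lambda>\<omega>. glue f g (i \<omega>)) \<longleftrightarrow> integrable P g"
      by (intro Bochner_Integration.integrable_cong; simp)+
    then show ?thesis by (simp add: int_M)
  qed
  have norm_M: "(LINT x|M. \<bar>f x\<bar>) = (LINT s|?A. \<bar>f (e s)\<bar>) + (LINT \<omega>|P. \<bar>f (i \<omega>)\<bar>)"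
    if "integrable M f" for f :: "real \<Rightarrow> real"
    using that unfolding M_def by (intro integral_glued_nonneg) auto
  define H where "H = {f :: real \<Rightarrow> real. integrable M f \<and> (LINT s|?A. f (e s)) = 0}"
  define q where "q s t \<omega> = F (s \<otimes>\<^bsub>G\<^esub> t) \<omega> - F t (\<alpha> (inv\<^bsub>G\<^esub> s) \<omega>) - F s \<omega>" for s t \<omega>
  define T where "T s f = glue (\<lambda>t. f (e (inv\<^bsub>G\<^esub> s \<otimes>\<^bsub>G\<^esub> t)))
    (\<lambda>\<omega>. f (i (\<alpha> (inv\<^bsub>G\<^esub> s) \<omega>)) + (LINT t|?A. f (e t) * q s t \<omega>))" for s f
  define \<beta> where "\<beta> s = glue (\<lambda>t. of_bool (t = s) - of_bool (t = \<one>\<^bsub>G\<^esub>)) (F s)" for s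
  have \<alpha>_space [simp]: "\<alpha> s \<omega> \<in> space P" if "s \<in> ?\<Gamma>" "\<omega> \<in> space P" for s \<omega>
    using measurable_space[OF \<alpha>_meas[OF that(1)] that(2)] .
  have q_le: "\<bar>q s t \<omega>\<bar> \<le> K" if "s \<in> ?\<Gamma>" "t \<in> ?\<Gamma>" "\<omega> \<in> space P" for s t \<omega>
    unfolding q_def using defect that by simp
  have K: "0 \<le> K" using q_le[of "\<one>\<^bsub>G\<^esub>" "\<one>\<^bsub>G\<^esub>"] P.not_empty by force
  have H_A: "integrable ?A (\<lambda>s. f (e s))" and H_P: "integrable P (\<lambda>\<omega>. f (i \<omega>))"
    and H_sum: "(LINT s|?A. f (e s)) = 0" if "f \<in> H" for f
    using that by (auto simp: H_def int_M)
  have shift: "bij_betw (\<lambda>t. s \<otimes>\<^bsub>G\<^esub> t) ?\<Gamma> ?\<Gamma>" if "s \<in> ?\<Gamma>" for s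
    using that by (intro bij_betw_byWitness[where f' = "\<lambda>t. inv\<^bsub>G\<^esub> s \<otimes>\<^bsub>G\<^esub> t"])
      (auto simp flip: m_assoc)
  have q_int: "integrable ?A (\<lambda>t. f (e t) * q s t \<omega>)"
    and q_bound: "\<bar>LINT t|?A. f (e t) * q s t \<omega>\<bar> \<le> K * (LINT t|?A. \<bar>f (e t)\<bar>)"
    if "f \<in> H" "s \<in> ?\<Gamma>" "\<omega> \<in> space P" for f s \<omega>
    using integrable_count_times_bounded[OF H_A[OF that(1)], of "\<lambda>t. q s t \<omega>" K] q_le that(2,3) by auto
  have \<alpha>_int: "integrable P (\<lambda>\<omega>. f (\<alpha> s \<omega>))" "(LINT \<omega>|P. f (\<alpha> s \<omega>)) = (LINT \<omega>|P. f \<omega>)"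
    if "s \<in> ?\<Gamma>" "integrable P f" for s and f :: "'w \<Rightarrow> real"
  proof -
    have f: "f \<in> borel_measurable P" using that(2) by simp
    show "integrable P (\<lambda>\<omega>. f (\<alpha> s \<omega>))"
      using integrable_distr_eq[OF \<alpha>_meas[OF that(1)] f] that(2) \<alpha>_pres[OF that(1)] by simp
    show "(LINT \<omega>|P. f (\<alpha> s \<omega>)) = (LINT \<omega>|P. f \<omega>)"
      using integral_distr[OF \<alpha>_meas[OF that(1)] f] \<alpha>_pres[OF that(1)] by simp
  qed
  have F_meas: "F s \<in> borel_measurable P" if "s \<in> ?\<Gamma>" for s using F_int[OF that] by simp
  have q_meas: "q s t \<in> borel_measurable P" if "s \<in> ?\<Gamma>" "t \<in> ?\<Gamma>" for s t
  proof -
    have "(\<lambda>\<omega>. F t (\<alpha> (inv\<^bsub>G\<^esub> s) \<omega>)) \<in> borel_measurable P"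
      using that by (intro measurable_compose[OF \<alpha>_meas F_meas]) auto
    moreover have "F (s \<otimes>\<^bsub>G\<^esub> t) \<in> borel_measurable P" "F s \<in> borel_measurable P"
      using that by (auto intro!: F_meas)
    ultimately show ?thesis unfolding q_def by measurable
  qed
  have Q_meas: "(\<lambda>\<omega>. LINT t|?A. f (e t) * q s t \<omega>) \<in> borel_measurable P"
    if "s \<in> ?\<Gamma>" for s and f :: "real \<Rightarrow> real"
  proof -
    interpret A: sigma_finite_measure ?A by (rule sigma_finite_measure_count_space_countable[OF countable])
    have "(\<lambda>(t, \<omega>). f (e t) * q s t \<omega>) \<in> borel_measurable (?A \<Otimes>\<^sub>M P)"
      using q_meas[OF that] by (intro measurable_pair_measure_countable1[OF countable]) auto
    then have "(\<lambda>(\<omega>, t). f (e t) * q s t \<omega>) \<in> borel_measurable (P \<Otimes>\<^sub>M ?A)"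
      by (subst measurable_pair_swap_iff) (simp add: case_prod_beta')
    then show ?thesis by (rule A.borel_measurable_lebesgue_integral)
  qed
  have Q_int: "integrable P (\<lambda>\<omega>. LINT t|?A. f (e t) * q s t \<omega>)" if "s \<in> ?\<Gamma>" "f \<in> H" for s f
    using q_bound[OF that(2,1)] Q_meas[OF that(1)]
    by (intro P.integrable_const_bound[where B = "K * (LINT t|?A. \<bar>f (e t)\<bar>)"]) auto
  have T_parts: "integrable ?A (\<lambda>t. f (e (inv\<^bsub>G\<^esub> s \<otimes>\<^bsub>G\<^esub> t)))"
    "integrable P (\<lambda>\<omega>. f (i (\<alpha> (inv\<^bsub>G\<^esub> s) \<omega>)))"
    if "s \<in> ?\<Gamma>" "f \<in> H" for s f
    using H_A[OF that(2)] H_P[OF that(2)] that integrable_bij_count_space[OF shift[of "inv\<^bsub>G\<^esub> s"], of "\<lambda>s. f (e s)"]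
      \<alpha>_int(1)[of "inv\<^bsub>G\<^esub> s" "\<lambda>\<omega>. f (i \<omega>)"] by auto
  have T_int: "integrable M (T s f)" if "s \<in> ?\<Gamma>" "f \<in> H" for s f
    unfolding T_def int_glue using T_parts[OF that] Q_int[OF that] by auto
  have Te: "T s f (e t) = f (e (inv\<^bsub>G\<^esub> s \<otimes>\<^bsub>G\<^esub> t))" if "t \<in> ?\<Gamma>" for s f t
    using that by (simp add: T_def)
  have Ti: "T s f (i \<omega>) = f (i (\<alpha> (inv\<^bsub>G\<^esub> s) \<omega>)) + (LINT t|?A. f (e t) * q s t \<omega>)"
    if "\<omega> \<in> space P" for s f \<omega>
    using that by (simp add: T_def)
  have A_cong: "(LINT t|?A. f t) = (LINT t|?A. g t)" if "\<And>t. t \<in> ?\<Gamma> \<Longrightarrow> f t = g t" for f g :: "'g \<Rightarrow> real"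
    using that by (intro Bochner_Integration.integral_cong) auto
  have A_shift: "(LINT t|?A. f (inv\<^bsub>G\<^esub> s \<otimes>\<^bsub>G\<^esub> t)) = (LINT t|?A. f t)" if "s \<in> ?\<Gamma>" for s and f :: "'g \<Rightarrow> real"
    using integral_bij_count_space[OF shift[of "inv\<^bsub>G\<^esub> s"], of f] that by simp
  have "\<exists>E \<pi> b. L1_closed_subspace M E \<and> L1_affine_action G M E \<pi> b \<and>
      L1_uniformly_lipschitz G M E \<pi> b \<and> L1_unbounded_orbits G M E \<pi> b"
  proof (rule L1_action_from_functions[where H = H and T = T and \<beta> = \<beta> and C = "1 + K"])
    show "group G" by (rule G)
    show "integrable M f" if "f \<in> H" for f using that by (simp add: H_def)
    show "(\<lambda>_. 0) \<in> H" by (simp add: H_def)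
    show "(\<lambda>x. f x + g x) \<in> H" if "f \<in> H" "g \<in> H" for f g
      using that by (simp add: H_def int_M)
    show "(\<lambda>x. c * f x) \<in> H" if "f \<in> H" for c f
      using that by (simp add: H_def int_M)
    show "f \<in> H" if f: "integrable M f" and approx: "\<And>e. e > 0 \<Longrightarrow> \<exists>h\<in>H. (LINT x|M. \<bar>f x - h x\<bar>) < e" for f
    proof -
      have small: "\<bar>LINT s|?A. f (e s)\<bar> \<le> 0 + \<epsilon>" if \<epsilon>: "\<epsilon> > 0" for \<epsilon>
      proof -
        obtain h where h: "h \<in> H" "(LINT x|M. \<bar>f x - h x\<bar>) < \<epsilon>" using approx[OF \<epsilon>] by blast
        have fA: "integrable ?A (\<lambda>s. f (e s))" using f by (simp add: int_M)
        have "(LINT s|?A. f (e s)) = (LINT s|?A. f (e s) - h (e s))"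
          using fA H_A[OF h(1)] H_sum[OF h(1)] by simp
        also have "\<bar>\<dots>\<bar> \<le> (LINT s|?A. \<bar>f (e s) - h (e s)\<bar>)" by (rule integral_abs_bound)
        also have "\<dots> \<le> (LINT x|M. \<bar>f x - h x\<bar>)"
        proof -
          have "integrable M (\<lambda>x. f x - h x)" using f h(1) by (simp add: H_def)
          then show ?thesis by (subst norm_M) simp_all
        qed
        finally show ?thesis using h(2) by linarith
      qed
      have "\<bar>LINT s|?A. f (e s)\<bar> \<le> 0" by (rule field_le_epsilon[OF small])
      then show ?thesis using f by (simp add: H_def)
    qed
    show "T s f \<in> H" if "s \<in> ?\<Gamma>" "f \<in> H" for s f
    proof -
      have "(LINT t|?A. T s f (e t)) = (LINT t|?A. f (e (inv\<^bsub>G\<^esub> s \<otimes>\<^bsub>G\<^esub> t)))" by (rule A_cong) (rule Te)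
      also have "\<dots> = 0" using A_shift[OF that(1), of "\<lambda>t. f (e t)"] H_sum[OF that(2)] by simp
      finally show ?thesis using T_int[OF that] by (simp add: H_def)
    qed
    show "T s (\<lambda>x. f x + g x) x = T s f x + T s g x"
      if s: "s \<in> ?\<Gamma>" and fg: "f \<in> H" "g \<in> H" and x: "x \<in> space M" for s f g x
      using x q_int[OF fg(1) s] q_int[OF fg(2) s] unfolding space_M
      by (auto simp: Te Ti distrib_right)
    show "T s (\<lambda>x. c * f x) x = c * T s f x" if s: "s \<in> ?\<Gamma>" and f: "f \<in> H" and x: "x \<in> space M" for s c f x
      using x unfolding space_M by (auto simp: Te Ti distrib_left mult.assoc)
    show "(LINT x|M. \<bar>T s f x\<bar>) \<le> (1 + K) * (LINT x|M. \<bar>f x\<bar>)" if s: "s \<in> ?\<Gamma>" and f: "f \<in> H" for s f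
    proof -
      define n where "n = (LINT t|?A. \<bar>f (e t)\<bar>)"
      have "(LINT t|?A. \<bar>T s f (e t)\<bar>) = (LINT t|?A. \<bar>f (e (inv\<^bsub>G\<^esub> s \<otimes>\<^bsub>G\<^esub> t))\<bar>)"
        by (rule A_cong) (simp add: Te)
      also have "\<dots> = n" using A_shift[OF s, of "\<lambda>t. \<bar>f (e t)\<bar>"] by (simp add: n_def)
      finally have 1: "(LINT t|?A. \<bar>T s f (e t)\<bar>) = n" .
      have "(LINT \<omega>|P. \<bar>T s f (i \<omega>)\<bar>) \<le> (LINT \<omega>|P. \<bar>f (i (\<alpha> (inv\<^bsub>G\<^esub> s) \<omega>))\<bar> + K * n)"
      proof (rule integral_mono)
        show "integrable P (\<lambda>\<omega>. \<bar>T s f (i \<omega>)\<bar>)" using T_int[OF s f] by (simp add: int_M)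
        show "integrable P (\<lambda>\<omega>. \<bar>f (i (\<alpha> (inv\<^bsub>G\<^esub> s) \<omega>))\<bar> + K * n)" using T_parts(2)[OF s f] by simp
        show "\<bar>T s f (i \<omega>)\<bar> \<le> \<bar>f (i (\<alpha> (inv\<^bsub>G\<^esub> s) \<omega>))\<bar> + K * n" if "\<omega> \<in> space P" for \<omega>
          using q_bound[OF f s that] unfolding n_def Ti[OF that] by linarith
      qed
      also have "\<dots> = (LINT \<omega>|P. \<bar>f (i (\<alpha> (inv\<^bsub>G\<^esub> s) \<omega>))\<bar>) + K * n"
        using T_parts(2)[OF s f] by (simp add: P.prob_space)
      also have "(LINT \<omega>|P. \<bar>f (i (\<alpha> (inv\<^bsub>G\<^esub> s) \<omega>))\<bar>) = (LINT \<omega>|P. \<bar>f (i \<omega>)\<bar>)"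
        using \<alpha>_int(2)[of "inv\<^bsub>G\<^esub> s" "\<lambda>\<omega>. \<bar>f (i \<omega>)\<bar>"] s H_P[OF f] by simp
      finally have 2: "(LINT \<omega>|P. \<bar>T s f (i \<omega>)\<bar>) \<le> (LINT \<omega>|P. \<bar>f (i \<omega>)\<bar>) + K * n" .
      have "0 \<le> K * (LINT \<omega>|P. \<bar>f (i \<omega>)\<bar>)" using K by simp
      moreover have "(LINT x|M. \<bar>f x\<bar>) = n + (LINT \<omega>|P. \<bar>f (i \<omega>)\<bar>)"
        using f by (subst norm_M) (auto simp: H_def n_def)
      ultimately show ?thesis
        using 1 2 norm_M[OF T_int[OF s f]] by (simp add: algebra_simps)
    qed
    show "T \<one>\<^bsub>G\<^esub> f x = f x" if "f \<in> H" "x \<in> space M" for f x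
    proof -
      have "(LINT t|?A. f (e t) * q \<one>\<^bsub>G\<^esub> t \<omega>) = 0" if "\<omega> \<in> space P" for \<omega>
      proof -
        have "(LINT t|?A. f (e t) * q \<one>\<^bsub>G\<^esub> t \<omega>) = (LINT t|?A. 0)"
          by (rule A_cong) (use that in \<open>simp add: q_def F_one \<alpha>_one\<close>)
        then show ?thesis by simp
      qed
      then show ?thesis using that unfolding space_M by (auto simp: Te Ti \<alpha>_one)
    qed
    show "T (s \<otimes>\<^bsub>G\<^esub> t) f x = T s (T t f) x"
      if s: "s \<in> ?\<Gamma>" and t: "t \<in> ?\<Gamma>" and f: "f \<in> H" and x: "x \<in> space M" for s t f x
    proof (cases "x \<in> e ` ?\<Gamma>")
      case True
      then obtain r where "r \<in> ?\<Gamma>" "x = e r" by blast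
      then show ?thesis using s t by (simp add: Te inv_mult_group m_assoc)
    next
      case False
      then obtain \<omega> where \<omega>: "\<omega> \<in> space P" "x = i \<omega>" using x unfolding space_M by blast
      define \<omega>' where "\<omega>' = \<alpha> (inv\<^bsub>G\<^esub> s) \<omega>"
      have \<omega>': "\<omega>' \<in> space P" "\<alpha> (inv\<^bsub>G\<^esub> (s \<otimes>\<^bsub>G\<^esub> t)) \<omega> = \<alpha> (inv\<^bsub>G\<^esub> t) \<omega>'"
        using s t \<omega> by (simp_all add: \<omega>'_def inv_mult_group \<alpha>_mult)
      have "(LINT r|?A. T t f (e r) * q s r \<omega>) = (LINT r|?A. f (e (inv\<^bsub>G\<^esub> t \<otimes>\<^bsub>G\<^esub> r)) * q s (t \<otimes>\<^bsub>G\<^esub> (inv\<^bsub>G\<^esub> t \<otimes>\<^bsub>G\<^esub> r)) \<omega>)"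
        using t by (intro A_cong) (simp add: Te flip: m_assoc)
      also have "\<dots> = (LINT r|?A. f (e r) * q s (t \<otimes>\<^bsub>G\<^esub> r) \<omega>)"
        using A_shift[OF t, of "\<lambda>r. f (e r) * q s (t \<otimes>\<^bsub>G\<^esub> r) \<omega>"] .
      also have "\<dots> = (LINT r|?A. (f (e r) * q (s \<otimes>\<^bsub>G\<^esub> t) r \<omega> - f (e r) * q t r \<omega>') + q s t \<omega> * f (e r))"
      proof (rule A_cong)
        fix r assume r: "r \<in> ?\<Gamma>"
        \<comment> \<open>The last summand is constant in \<open>r\<close> and disappears on summation.\<close>
        have qq: "q s (t \<otimes>\<^bsub>G\<^esub> r) \<omega> = q (s \<otimes>\<^bsub>G\<^esub> t) r \<omega> - q t r \<omega>' + q s t \<omega>"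
          using s t r \<omega>' by (simp add: q_def m_assoc \<omega>'_def)
        show "f (e r) * q s (t \<otimes>\<^bsub>G\<^esub> r) \<omega> = (f (e r) * q (s \<otimes>\<^bsub>G\<^esub> t) r \<omega> - f (e r) * q t r \<omega>') + q s t \<omega> * f (e r)"
          unfolding qq by (simp add: algebra_simps)
      qed
      also have "\<dots> = (LINT r|?A. f (e r) * q (s \<otimes>\<^bsub>G\<^esub> t) r \<omega>) - (LINT r|?A. f (e r) * q t r \<omega>')"
        using q_int[OF f _ \<omega>(1), of "s \<otimes>\<^bsub>G\<^esub> t"] q_int[OF f t \<omega>'(1)] H_A[OF f] H_sum[OF f] s t by simp
      finally show ?thesis using \<omega> \<omega>' by (simp add: Ti) (simp add: Ti flip: \<omega>'_def)
    qed
    have delta_int: "integrable ?A (\<lambda>t. (of_bool (t = s) :: real) * g t)"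
      "(LINT t|?A. of_bool (t = s) * g t) = g s" if "s \<in> ?\<Gamma>" for s and g :: "'g \<Rightarrow> real"
    proof -
      have eq: "(\<lambda>t. (of_bool (t = s) :: real) * g t) = (\<lambda>t. indicator {s} t *\<^sub>R g s)"
        by (auto simp: fun_eq_iff split: split_indicator)
      show "integrable ?A (\<lambda>t. (of_bool (t = s) :: real) * g t)" "(LINT t|?A. of_bool (t = s) * g t) = g s"
        unfolding eq using that by (auto simp: emeasure_count_space)
    qed
    show "\<beta> s \<in> H" if s: "s \<in> ?\<Gamma>" for s
    proof -
      have "(LINT t|?A. \<beta> s (e t)) = (LINT t|?A. of_bool (t = s) * 1 - of_bool (t = \<one>\<^bsub>G\<^esub>) * 1)"
        by (rule A_cong) (simp add: \<beta>_def)
      then show ?thesis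
        using s delta_int[of s "\<lambda>_. 1"] delta_int[of "\<one>\<^bsub>G\<^esub>" "\<lambda>_. 1"] F_int[OF s]
        by (simp add: H_def \<beta>_def int_glue)
    qed
    show "\<beta> (s \<otimes>\<^bsub>G\<^esub> t) x = T s (\<beta> t) x + \<beta> s x"
      if s: "s \<in> ?\<Gamma>" and t: "t \<in> ?\<Gamma>" and x: "x \<in> space M" for s t x
    proof (cases "x \<in> e ` ?\<Gamma>")
      case True
      then obtain r where r: "r \<in> ?\<Gamma>" "x = e r" by blast
      have solve: "inv\<^bsub>G\<^esub> s \<otimes>\<^bsub>G\<^esub> r = u \<longleftrightarrow> r = s \<otimes>\<^bsub>G\<^esub> u" if "u \<in> ?\<Gamma>" for u
        by (subst eq_commute, rule inv_solve_left) (use s r(1) that in simp_all)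
      have "inv\<^bsub>G\<^esub> s \<otimes>\<^bsub>G\<^esub> r = t \<longleftrightarrow> r = s \<otimes>\<^bsub>G\<^esub> t" "inv\<^bsub>G\<^esub> s \<otimes>\<^bsub>G\<^esub> r = \<one>\<^bsub>G\<^esub> \<longleftrightarrow> r = s"
        using solve[OF t] solve[OF one_closed] s by simp_all
      then show ?thesis using s t r by (simp add: Te \<beta>_def)
    next
      case False
      then obtain \<omega> where \<omega>: "\<omega> \<in> space P" "x = i \<omega>" using x unfolding space_M by blast
      have "(LINT r|?A. \<beta> t (e r) * q s r \<omega>) = (LINT r|?A. of_bool (r = t) * q s r \<omega> - of_bool (r = \<one>\<^bsub>G\<^esub>) * q s r \<omega>)"
        by (rule A_cong) (simp add: \<beta>_def algebra_simps)
      also have "\<dots> = q s t \<omega> - q s \<one>\<^bsub>G\<^esub> \<omega>"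
        using delta_int[OF t, of "\<lambda>r. q s r \<omega>"] delta_int[of "\<one>\<^bsub>G\<^esub>" "\<lambda>r. q s r \<omega>"] by simp
      also have "q s \<one>\<^bsub>G\<^esub> \<omega> = 0" using s \<omega> by (simp add: q_def F_one)
      finally show ?thesis using s t \<omega> by (simp add: Ti \<beta>_def q_def)
    qed
    show "\<exists>s\<in>?\<Gamma>. B < (LINT x|M. \<bar>\<beta> s x\<bar>)" for B
    proof -
      obtain s where s: "s \<in> ?\<Gamma>" "B < (LINT \<omega>|P. \<bar>F s \<omega>\<bar>)" using unbounded by blast
      have "integrable M (\<beta> s)"
        using s delta_int(1)[of s "\<lambda>_. 1"] delta_int(1)[of "\<one>\<^bsub>G\<^esub>" "\<lambda>_. 1"] F_int[OF s(1)]
        by (simp add: \<beta>_def int_glue)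
      then have "(LINT x|M. \<bar>\<beta> s x\<bar>) = (LINT t|?A. \<bar>\<beta> s (e t)\<bar>) + (LINT \<omega>|P. \<bar>\<beta> s (i \<omega>)\<bar>)" by (rule norm_M)
      moreover have "(LINT \<omega>|P. \<bar>\<beta> s (i \<omega>)\<bar>) = (LINT \<omega>|P. \<bar>F s \<omega>\<bar>)"
        by (rule Bochner_Integration.integral_cong) (simp_all add: \<beta>_def)
      moreover have "0 \<le> (LINT t|?A. \<bar>\<beta> s (e t)\<bar>)" by simp
      ultimately have "B < (LINT x|M. \<bar>\<beta> s x\<bar>)" using s(2) by linarith
      then show ?thesis using s(1) by blast
    qed
  qed
  then show ?thesis by blast
qed

section \<open>Hyperbolic metric spaces and their boundary\<close>

locale hyperbolic_metric = Metric_space S d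
  for S :: "'s set" and d :: "'s \<Rightarrow> 's \<Rightarrow> real" +
  fixes \<delta> :: real
  assumes delta_nonneg: "0 \<le> \<delta>"
    and hyperbolic_gromov: "\<lbrakk>w \<in> S; x \<in> S; y \<in> S; z \<in> S\<rbrakk> \<Longrightarrow>
      gromov_product d w x z \<ge> min (gromov_product d w x y) (gromov_product d w y z) - \<delta>"
begin

text \<open>
  The length of the detour made when going from \<open>x\<close> to \<open>y\<close> via \<open>m\<close>: twice the Gromov product
  of \<open>x\<close> and \<open>y\<close> based at \<open>m\<close>. It is small if and only if \<open>m\<close> is near the geodesics from \<open>x\<close>
  to \<open>y\<close>, and it replaces geodesics in the arguments below.
\<close>
definition excess :: "'s \<Rightarrow> 's \<Rightarrow> 's \<Rightarrow> real" where
  "excess x m y = d x m + d m y - d x y"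

lemma excess_nonneg: "\<lbrakk>x \<in> S; m \<in> S; y \<in> S\<rbrakk> \<Longrightarrow> 0 \<le> excess x m y"
  using triangle[of x m y] by (simp add: excess_def)

lemma excess_commute: "excess x m y = excess y m x"
  by (simp add: excess_def commute)

lemma excess_left [simp]: "x \<in> S \<Longrightarrow> excess x x y = 0"
  by (simp add: excess_def)

lemma excess_right [simp]: "y \<in> S \<Longrightarrow> excess x y y = 0"
  by (simp add: excess_def)

text \<open>
  Of the three ways to pair four points, the two with the largest sums of distances differ
  by at most \<open>2 * \<delta>\<close>. All further geometric estimates are linear consequences of this and of
  the triangle inequality.
\<close>
lemma four_point:
  assumes "w \<in> S" "x \<in> S" "y \<in> S" "z \<in> S"
  shows "d x z + d w y \<le> max (d x y + d w z) (d w x + d y z) + 2 * \<delta>"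
proof -
  have "gromov_product d w x y - \<delta> \<le> gromov_product d w x z
      \<or> gromov_product d w y z - \<delta> \<le> gromov_product d w x z"
    using hyperbolic_gromov[OF assms] by (simp add: min_def split: if_splits)
  then have "d x z + d w y \<le> d x y + d w z + 2 * \<delta> \<or> d x z + d w y \<le> d w x + d y z + 2 * \<delta>"
    unfolding gromov_product_def by argo
  then show ?thesis by (auto simp: max_def)
qed

text \<open>
  Two small detours with a long step between them: in a tree the two segments would overlap
  in the step from \<open>p\<close> to \<open>q\<close> and form one geodesic. The new bound at \<open>q\<close> involves only the
  local bound at \<open>q\<close>, so that errors do not accumulate when the estimate is iterated along a
  chain.
\<close>
lemma excess_local_to_global:
  assumes S: "x \<in> S" "p \<in> S" "q \<in> S" "y \<in> S"
    and "excess x p q \<le> b" "excess p q y \<le> b'" "b + b' + 2 * \<delta> < 2 * d p q"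
  shows "excess x q y \<le> b' + 2 * \<delta>" "excess x p y \<le> b + 2 * \<delta>"
  using four_point[of x p y q] four_point[of x p q y] four_point[of x q p y] assms
  by (auto simp: excess_def commute max_def split: if_splits)

lemma dist_of_small_excess:
  assumes S: "x \<in> S" "p \<in> S" "q \<in> S" "y \<in> S"
    and "excess x p y \<le> b" "excess x q y \<le> b"
  shows "d p q \<le> \<bar>d x p - d x q\<bar> + b + 2 * \<delta>"
  using four_point[of x p y q] four_point[of x p q y] four_point[of x q p y] assms
  by (auto simp: excess_def commute max_def split: if_splits)

text \<open>
  In a tree, the centre of the triangle lies on the side from \<open>x\<close> to \<open>y\<close> at distance
  \<open>gromov_product d x y z\<close> from \<open>x\<close>.
\<close>
lemma exists_centre:
  assumes geo: "geodesic_space S d" and S: "x \<in> S" "y \<in> S" "z \<in> S"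
  obtains m where "m \<in> S" "excess x m y \<le> 2 * \<delta>" "excess y m z \<le> 2 * \<delta>" "excess x m z \<le> 2 * \<delta>"
proof -
  obtain \<gamma> where \<gamma>: "\<gamma> 0 = x" "\<gamma> (d x y) = y" "\<gamma> ` {0..d x y} \<subseteq> S"
    "\<And>s t. s \<in> {0..d x y} \<Longrightarrow> t \<in> {0..d x y} \<Longrightarrow> d (\<gamma> s) (\<gamma> t) = \<bar>s - t\<bar>"
    using geo S unfolding geodesic_space_def by metis
  define t where "t = gromov_product d x y z"
  have t: "0 \<le> t" "t \<le> d x y"
    using triangle[of x y z] triangle[of x z y] triangle[of y x z] S
    by (auto simp: t_def gromov_product_def commute)
  have m: "\<gamma> t \<in> S" using \<gamma>(3) t by auto
  have dist: "d x (\<gamma> t) = t" "d (\<gamma> t) y = d x y - t"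
    using \<gamma>(4)[of 0 t] \<gamma>(4)[of t "d x y"] \<gamma>(1,2) t by auto
  have t2: "2 * t = d x y + d x z - d y z"
    by (simp add: t_def gromov_product_def)
  have *: "d (\<gamma> t) z \<le> d x z - t + 2 * \<delta>"
    using four_point[of x "\<gamma> t" y z] m S dist t2 by simp
  have "d y (\<gamma> t) = d x y - t" using dist by (simp add: commute)
  then show thesis
    using that[OF m] * dist t2 delta_nonneg by (simp add: excess_def)
qed

end

lemma gromov_products_diverge_iff:
  "gromov_products_diverge S d x y \<longleftrightarrow>
    (\<forall>w\<in>S. \<forall>B. \<exists>N. \<forall>i\<ge>N. \<forall>j\<ge>N. B \<le> gromov_product d w (x i) (y j))"
  unfolding gromov_products_diverge_def filterlim_at_top eventually_prod_sequentially
  by (simp only: case_prod_conv) (meson)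

context hyperbolic_metric begin

lemma gromov_products_diverge_sym:
  assumes "range x \<subseteq> S" "range y \<subseteq> S" "gromov_products_diverge S d x y"
  shows "gromov_products_diverge S d y x"
proof -
  have "gromov_product d w (y i) (x j) = gromov_product d w (x j) (y i)" for w i j
    by (simp add: gromov_product_def commute)
  then show ?thesis using assms(3) unfolding gromov_products_diverge_iff by metis
qed

lemma gromov_products_diverge_trans:
  assumes S: "range x \<subseteq> S" "range y \<subseteq> S" "range z \<subseteq> S"
    and "gromov_products_diverge S d x y" "gromov_products_diverge S d y z"
  shows "gromov_products_diverge S d x z"
  unfolding gromov_products_diverge_iff
proof (intro ballI allI)
  fix w B assume w: "w \<in> S"
  obtain N where N: "\<And>i j. i \<ge> N \<Longrightarrow> j \<ge> N \<Longrightarrow> B + \<delta> \<le> gromov_product d w (x i) (y j)"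
    using assms(4) w unfolding gromov_products_diverge_iff by blast
  obtain N' where N': "\<And>i j. i \<ge> N' \<Longrightarrow> j \<ge> N' \<Longrightarrow> B + \<delta> \<le> gromov_product d w (y i) (z j)"
    using assms(5) w unfolding gromov_products_diverge_iff by blast
  have "B \<le> gromov_product d w (x i) (z j)" if "i \<ge> max N N'" "j \<ge> max N N'" for i j
  proof -
    have "x i \<in> S" "y (max N N') \<in> S" "z j \<in> S" using S by auto
    note hyperbolic_gromov[OF w this]
    moreover have "B + \<delta> \<le> gromov_product d w (x i) (y (max N N'))"
      "B + \<delta> \<le> gromov_product d w (y (max N N')) (z j)"
      using N[of i "max N N'"] N'[of "max N N'" j] that by auto
    ultimately show ?thesis by linarith
  qed
  then show "\<exists>N. \<forall>i\<ge>N. \<forall>j\<ge>N. B \<le> gromov_product d w (x i) (z j)" by blast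
qed

text \<open>
  Boundary points are classes of an equivalence relation; transitivity of the relation is
  the Gromov inequality for products.
\<close>
lemma distinct_boundary_points_not_asymptotic:
  assumes \<xi>: "\<xi> \<in> gromov_boundary S d" "x \<in> \<xi>" and \<eta>: "\<eta> \<in> gromov_boundary S d" "y \<in> \<eta>"
    and "\<xi> \<noteq> \<eta>"
  shows "\<not> gromov_products_diverge S d x y"
proof
  assume xy: "gromov_products_diverge S d x y"
  let ?r = "{(x, y). x \<in> gromov_sequences S d \<and> y \<in> gromov_sequences S d \<and> gromov_products_diverge S d x y}"
  have equiv: "equiv (gromov_sequences S d) ?r"
  proof (rule equivI)
    show "?r \<subseteq> gromov_sequences S d \<times> gromov_sequences S d" by auto
    show "refl_on (gromov_sequences S d) ?r" by (auto simp: refl_on_def gromov_sequences_def)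
    show "sym ?r"
    proof (rule symI)
      fix x y assume "(x, y) \<in> ?r"
      then show "(y, x) \<in> ?r"
        using gromov_products_diverge_sym[of x y] by (simp add: gromov_sequences_def)
    qed
    show "trans ?r"
    proof (rule transI)
      fix x y z assume "(x, y) \<in> ?r" "(y, z) \<in> ?r"
      then show "(x, z) \<in> ?r"
        using gromov_products_diverge_trans[of x y z] by (simp add: gromov_sequences_def)
    qed
  qed
  note quot = \<xi>(1)[unfolded gromov_boundary_def] \<eta>(1)[unfolded gromov_boundary_def]
  have "x \<in> gromov_sequences S d" "y \<in> gromov_sequences S d"
    using in_quotient_imp_subset[OF equiv quot(1)] in_quotient_imp_subset[OF equiv quot(2)] \<xi>(2) \<eta>(2) by blast+
  then have "(x, y) \<in> ?r" using xy by simp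
  then have "\<xi> = \<eta>" by (rule quotient_eqI[OF equiv quot \<xi>(2) \<eta>(2)])
  then show False using assms(5) by simp
qed

end

text \<open>
  Orbit points far out towards two different limit points, seen from a base point, diverge
  after a bounded distance. The two limit points may come from orbits of different points;
  moving to one base point changes the estimates by a bounded amount.
\<close>
lemma limit_points_give_directions:
  assumes hyp: "hyperbolic_metric S d \<delta>" and act: "isometric_action G S d \<phi>"
    and nonel: "non_elementary_action G S d \<phi>"
  obtains x0 B where "x0 \<in> S" "0 \<le> B"
    "\<And>R. \<exists>g\<in>carrier G. \<exists>h\<in>carrier G. R \<le> d x0 (\<phi> g x0) \<and> R \<le> d x0 (\<phi> h x0) \<and>
      d (\<phi> g x0) x0 + d x0 (\<phi> h x0) - d (\<phi> g x0) (\<phi> h x0) \<le> B"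
proof -
  interpret hyperbolic_metric S d \<delta> by (rule hyp)
  have ga: "group_action G S \<phi>"
    and iso: "\<And>g x y. g \<in> carrier G \<Longrightarrow> x \<in> S \<Longrightarrow> y \<in> S \<Longrightarrow> d (\<phi> g x) (\<phi> g y) = d x y"
    using act by (auto simp: isometric_action_def)
  have "\<not> (\<exists>\<xi>. limit_set G S d \<phi> \<subseteq> {\<xi>})"
  proof
    assume "\<exists>\<xi>. limit_set G S d \<phi> \<subseteq> {\<xi>}"
    then obtain \<xi> where "limit_set G S d \<phi> \<subseteq> {\<xi>}" by blast
    then have "finite (limit_set G S d \<phi>)" "card (limit_set G S d \<phi>) \<le> 1"
      using finite_subset card_mono[of "{\<xi>}"] by fastforce+
    then show False using nonel by (simp add: non_elementary_action_def)
  qed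
  then obtain \<xi> \<eta> where limit: "\<xi> \<in> limit_set G S d \<phi>" "\<eta> \<in> limit_set G S d \<phi>" "\<xi> \<noteq> \<eta>" by blast
  then obtain p x q y where p: "p \<in> S" "x \<in> \<xi>" "range x \<subseteq> orbit G \<phi> p"
    and q: "q \<in> S" "y \<in> \<eta>" "range y \<subseteq> orbit G \<phi> q"
    and bd: "\<xi> \<in> gromov_boundary S d" "\<eta> \<in> gromov_boundary S d"
    unfolding limit_set_def by blast
  have seq: "gromov_products_diverge S d x x" "gromov_products_diverge S d y y" "range x \<subseteq> S" "range y \<subseteq> S"
    using p q bd unfolding gromov_boundary_def quotient_def by (auto simp: gromov_sequences_def)
  obtain v B where v: "v \<in> S" and B: "\<And>N. \<exists>i\<ge>N. \<exists>j\<ge>N. gromov_product d v (x i) (y j) < B"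
    using distinct_boundary_points_not_asymptotic[OF bd(1) p(2) bd(2) q(2) limit(3)]
    unfolding gromov_products_diverge_iff by (meson not_le)
  define B' where "B' = max 0 (2 * B + 2 * d v p + 2 * d p q)"
  have "\<exists>g\<in>carrier G. \<exists>h\<in>carrier G. R \<le> d p (\<phi> g p) \<and> R \<le> d p (\<phi> h p) \<and>
      d (\<phi> g p) p + d p (\<phi> h p) - d (\<phi> g p) (\<phi> h p) \<le> B'" for R
  proof -
    obtain N1 where N1: "\<And>i. i \<ge> N1 \<Longrightarrow> R \<le> gromov_product d p (x i) (x i)"
      using seq(1) p(1) unfolding gromov_products_diverge_iff by blast
    obtain N2 where N2: "\<And>j. j \<ge> N2 \<Longrightarrow> R + d p q \<le> gromov_product d p (y j) (y j)"
      using seq(2) p(1) unfolding gromov_products_diverge_iff by blast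
    obtain i j where ij: "i \<ge> max N1 N2" "j \<ge> max N1 N2" "gromov_product d v (x i) (y j) < B"
      using B by blast
    have "x i \<in> orbit G \<phi> p" "y j \<in> orbit G \<phi> q" using p(3) q(3) by auto
    then obtain g h where g: "g \<in> carrier G" "x i = \<phi> g p" and h: "h \<in> carrier G" "y j = \<phi> h q"
      by (auto simp: orbit_def)
    have in_S: "\<phi> g p \<in> S" "\<phi> h p \<in> S" "\<phi> h q \<in> S"
      using group_action.element_image[OF ga] g h p q by blast+
    have hd: "d (\<phi> h p) (\<phi> h q) = d p q" using iso h p q by simp
    have "R \<le> d p (\<phi> g p)" using N1[of i] ij in_S g by (simp add: gromov_product_def)
    moreover have "R + d p q \<le> d p (\<phi> h q)" using N2[of j] ij in_S h by (simp add: gromov_product_def)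
    moreover have "d v (\<phi> g p) + d v (\<phi> h q) - d (\<phi> g p) (\<phi> h q) < 2 * B"
      using ij(3) g h by (simp add: gromov_product_def)
    moreover have "d p (\<phi> h q) \<le> d p (\<phi> h p) + d p q" "d p (\<phi> h p) \<le> d p (\<phi> h q) + d p q"
      "d (\<phi> g p) (\<phi> h q) \<le> d (\<phi> g p) (\<phi> h p) + d p q"
      using triangle[of p "\<phi> h p" "\<phi> h q"] triangle[of p "\<phi> h q" "\<phi> h p"]
        triangle[of "\<phi> g p" "\<phi> h p" "\<phi> h q"] p in_S hd by (simp_all add: commute)
    moreover have "d (\<phi> g p) p \<le> d v (\<phi> g p) + d v p" "d p (\<phi> h q) \<le> d v p + d v (\<phi> h q)"
      using triangle[of "\<phi> g p" v p] triangle[of p v "\<phi> h q"] p v in_S by (simp_all add: commute)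
    moreover have "2 * B + 2 * d v p + 2 * d p q \<le> B'" by (simp add: B'_def)
    ultimately have "R \<le> d p (\<phi> g p)" "R \<le> d p (\<phi> h p)"
      "d (\<phi> g p) p + d p (\<phi> h p) - d (\<phi> g p) (\<phi> h p) \<le> B'"
      by linarith+
    then show ?thesis using g(1) h(1) by blast
  qed
  then show thesis using that[OF p(1), of B'] by (simp add: B'_def)
qed

section \<open>Metrics with shortcuts\<close>

text \<open>
  The cost of a route from \<open>x\<close> to \<open>y\<close> that uses the shortcuts in the given list, in this
  order: the shortcut \<open>i\<close> leads from \<open>p i\<close> to \<open>q i\<close> at the price \<open>c i\<close>, all other steps cost
  their length.
\<close>
fun route_cost ::
    "('s \<Rightarrow> 's \<Rightarrow> real) \<Rightarrow> ('i \<Rightarrow> 's) \<Rightarrow> ('i \<Rightarrow> 's) \<Rightarrow> ('i \<Rightarrow> real) \<Rightarrow> 's \<Rightarrow> 'i list \<Rightarrow> 's \<Rightarrow> real" where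
  "route_cost d p q c x [] y = d x y"
| "route_cost d p q c x (i # is) y = d x (p i) + c i + route_cost d p q c (q i) is y"

definition route_dist ::
    "('s \<Rightarrow> 's \<Rightarrow> real) \<Rightarrow> 'i set \<Rightarrow> ('i \<Rightarrow> 's) \<Rightarrow> ('i \<Rightarrow> 's) \<Rightarrow> ('i \<Rightarrow> real) \<Rightarrow> 's \<Rightarrow> 's \<Rightarrow> real" where
  "route_dist d J p q c x y = (INF is\<in>lists J. route_cost d p q c x is y)"

definition route_asymmetry ::
    "('s \<Rightarrow> 's \<Rightarrow> real) \<Rightarrow> 'i set \<Rightarrow> ('i \<Rightarrow> 's) \<Rightarrow> ('i \<Rightarrow> 's) \<Rightarrow> ('i \<Rightarrow> real) \<Rightarrow> 's \<Rightarrow> 's \<Rightarrow> real" where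
  "route_asymmetry d J p q c x y = route_dist d J p q c x y - route_dist d J p q c y x"

locale shortcuts = hyperbolic_metric S d \<delta>
  for S :: "'s set" and d :: "'s \<Rightarrow> 's \<Rightarrow> real" and \<delta> :: real +
  fixes J :: "'i set" and p q :: "'i \<Rightarrow> 's" and c :: "'i \<Rightarrow> real" and C :: real
  assumes p_in [simp]: "i \<in> J \<Longrightarrow> p i \<in> S" and q_in [simp]: "i \<in> J \<Longrightarrow> q i \<in> S"
    and C_nonneg: "0 \<le> C"
    and discount: "i \<in> J \<Longrightarrow> d (p i) (q i) - C \<le> c i"
    and long: "i \<in> J \<Longrightarrow> 3 * C + 3 * \<delta> + 3 \<le> d (p i) (q i)"
begin

abbreviation "cost \<equiv> route_cost d p q c"
abbreviation "rdist \<equiv> route_dist d J p q c"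

lemma c_pos: "i \<in> J \<Longrightarrow> 0 \<le> c i"
  using discount[of i] long[of i] C_nonneg delta_nonneg by linarith

lemma cost_nonneg: "is \<in> lists J \<Longrightarrow> 0 \<le> cost x is y"
  by (induction "is" arbitrary: x) (auto simp: c_pos)

lemma bdd_cost: "bdd_below ((\<lambda>is. cost x is y) ` lists J)"
  using cost_nonneg by (intro bdd_belowI[of _ 0]) auto

lemma rdist_le_cost: "is \<in> lists J \<Longrightarrow> rdist x y \<le> cost x is y"
  unfolding route_dist_def by (rule cINF_lower[OF bdd_cost])

lemma rdist_le: "rdist x y \<le> d x y"
  using rdist_le_cost[of "[]"] by simp

lemma rdist_nonneg: "0 \<le> rdist x y"
  unfolding route_dist_def by (intro cINF_greatest cost_nonneg) auto

lemma rdist_obtain: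
  assumes "e > 0" obtains "is" where "is \<in> lists J" "cost x is y < rdist x y + e"
proof -
  have "rdist x y < rdist x y + e" using assms by simp
  then show thesis using that
    unfolding route_dist_def by (subst (asm) cINF_less_iff[OF _ bdd_cost]) auto
qed

lemma cost_append:
  "cost x (is @ i # js) y = cost x is (p i) + c i + cost (q i) js y"
  by (induction "is" arbitrary: x) auto

lemma cost_triangle:
  assumes "x \<in> S" "y \<in> S" "z \<in> S" "is \<in> lists J" "js \<in> lists J"
  shows "cost x (is @ js) z \<le> cost x is y + cost y js z"
  using assms
proof (induction "is" arbitrary: x)
  case Nil
  then show ?case
    using triangle[of x y z] triangle[of x y "p (hd js)"] by (cases js) auto
next
  case (Cons i "is")
  then show ?case using Cons.IH[of "q i"] by simp
qed

lemma rdist_triangle: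
  assumes "x \<in> S" "y \<in> S" "z \<in> S"
  shows "rdist x z \<le> rdist x y + rdist y z"
proof (rule field_le_epsilon)
  fix e :: real assume "e > 0"
  then obtain "is" js where *: "is \<in> lists J" "cost x is y < rdist x y + e/2"
    "js \<in> lists J" "cost y js z < rdist y z + e/2"
    by (metis rdist_obtain half_gt_zero)
  have "rdist x z \<le> cost x (is @ js) z" using * by (intro rdist_le_cost) auto
  also have "\<dots> \<le> cost x is y + cost y js z" using * assms by (intro cost_triangle)
  finally show "rdist x z \<le> rdist x y + rdist y z + e" using * by simp
qed

text \<open>
  The infimum in \<open>route_dist\<close> need not be attained. An error of \<open>1\<close> is harmless, and it is
  inherited by the parts of a route.
\<close>
definition near_optimal :: "'s \<Rightarrow> 'i list \<Rightarrow> 's \<Rightarrow> bool" where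
  "near_optimal x is y \<longleftrightarrow> is \<in> lists J \<and> cost x is y \<le> rdist x y + 1"

lemma near_optimal_exists: obtains "is" where "near_optimal x is y"
proof -
  obtain "is" where "is \<in> lists J" "cost x is y < rdist x y + 1" using rdist_obtain[of 1 x y] by auto
  then show thesis using that[of "is"] by (simp add: near_optimal_def)
qed

lemma near_optimal_split:
  assumes "near_optimal x (is @ i # js) y" "x \<in> S" "y \<in> S"
  shows "near_optimal x is (p i)" "near_optimal (p i) (i # js) y"
proof -
  have J: "is \<in> lists J" "i \<in> J" "i # js \<in> lists J"
    and le: "cost x (is @ i # js) y \<le> rdist x y + 1"
    using assms(1) by (auto simp: near_optimal_def)
  have "cost x is (p i) + cost (p i) (i # js) y \<le> rdist x (p i) + rdist (p i) y + 1"
    using le cost_append[of x "is" i js y] rdist_triangle[of x "p i" y] assms J(2) by simp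
  moreover note rdist_le_cost[OF J(1), of x "p i"] rdist_le_cost[OF J(3), of "p i" y]
  ultimately show "near_optimal x is (p i)" "near_optimal (p i) (i # js) y"
    using J unfolding near_optimal_def by linarith+
qed

text \<open>
  A nearly optimal route cannot be much more expensive than the direct step, and each
  shortcut saves at most \<open>C\<close>. Hence the detour made by one or two shortcuts is bounded in
  terms of \<open>C\<close> alone, however long the shortcuts are.
\<close>
lemma near_optimal_one:
  assumes "near_optimal (p i) [i] y" "y \<in> S"
  shows "d (p i) (q i) - C - 1 \<le> d (p i) y" "excess (p i) (q i) y \<le> C + 1"
proof -
  have "i \<in> J" "d (p i) (p i) = 0" and *: "c i + d (q i) y \<le> d (p i) y + 1"
    using assms rdist_le[of "p i" y] by (auto simp: near_optimal_def)
  then show "d (p i) (q i) - C - 1 \<le> d (p i) y" "excess (p i) (q i) y \<le> C + 1"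
    using discount[of i] nonneg[of "q i" y] unfolding excess_def by linarith+
qed

lemma near_optimal_two:
  assumes "near_optimal (p i) [i, j] y" "y \<in> S"
  shows "excess (p i) (p j) y \<le> 2 * C + 1"
proof -
  have ij: "i \<in> J" "j \<in> J" using assms by (auto simp: near_optimal_def)
  show ?thesis
    using assms rdist_le[of "p i" y] discount[OF ij(1)] discount[OF ij(2)]
      triangle[of "p i" "q i" "p j"] triangle[of "p j" "q j" y] ij
    by (simp add: near_optimal_def excess_def)
qed

text \<open>
  The entry points of consecutive shortcuts form a chain with long steps and small local
  detours, so \<open>excess_local_to_global\<close> applies repeatedly. The step from \<open>x\<close> to the first
  shortcut and the step after the last one may be short, which is why the induction starts
  at the first entry point.
\<close>
lemma near_optimal_last:
  assumes "near_optimal x (is @ [i]) y" "x \<in> S" "y \<in> S"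
  shows "excess x (p i) y \<le> 2 * C + 1 + 2 * \<delta>"
  using assms
proof (induction "is" arbitrary: i y rule: rev_induct)
  case Nil
  then have i: "i \<in> J" by (simp add: near_optimal_def)
  show ?case
    using Nil rdist_le[of x y] discount[OF i] triangle[of "p i" "q i" y] i C_nonneg delta_nonneg
    by (simp add: near_optimal_def excess_def)
next
  case (snoc j "is")
  have ij: "i \<in> J" "j \<in> J" using snoc.prems by (auto simp: near_optimal_def)
  have *: "near_optimal x (is @ [j]) (p i)" "near_optimal (p j) [j, i] y"
    using snoc.prems near_optimal_split[of x "is @ [j]" i "[]" y] near_optimal_split[of x "is" j "[i]" y]
    by auto
  have **: "near_optimal (p j) [j] (p i)"
    using near_optimal_split(1)[of "p j" "[j]" i "[]" y] *(2) snoc.prems ij by simp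
  have "excess x (p i) y \<le> (2 * C + 1) + 2 * \<delta>"
    by (rule excess_local_to_global(1)[of x "p j" "p i" y])
      (use snoc.IH[OF *(1)] snoc.prems ij near_optimal_two[OF *(2)] near_optimal_one(1)[OF **]
         long[OF ij(2)] C_nonneg delta_nonneg in auto)
  then show ?case by simp
qed

text \<open>
  The same induction, run from the other end.
\<close>
lemma near_optimal_second:
  assumes "near_optimal (p i) (i # j # js) y" "y \<in> S"
  shows "excess (p i) (p j) y \<le> 2 * C + 1 + 2 * \<delta>"
  using assms
proof (induction js arbitrary: i j)
  case Nil
  then show ?case using near_optimal_two[of i j y] delta_nonneg by simp
next
  case (Cons k ks)
  have ijk: "i \<in> J" "j \<in> J" "k \<in> J" using Cons.prems by (auto simp: near_optimal_def)
  have 1: "near_optimal (p i) [i, j] (p k)"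
    using near_optimal_split(1)[of "p i" "[i, j]" k ks y] Cons.prems ijk by simp
  have 2: "near_optimal (p j) (j # k # ks) y"
    using near_optimal_split(2)[of "p i" "[i]" j "k # ks" y] Cons.prems ijk by simp
  have 3: "near_optimal (p j) [j] (p k)"
    using near_optimal_split(1)[of "p j" "[j]" k ks y] 2 Cons.prems ijk by simp
  show ?case
    by (rule excess_local_to_global(2)[of "p i" "p j" "p k" y])
      (use Cons.IH[OF 2] Cons.prems ijk near_optimal_two[OF 1] near_optimal_one(1)[OF 3]
         long[OF ijk(2)] C_nonneg delta_nonneg in auto)
qed

text \<open>
  How far, in terms of the excess, the entry points of a nearly optimal route may be from
  geodesics between its endpoints.
\<close>
definition tightness :: real where "tightness = 2 * C + 1 + 4 * \<delta>"

lemma tightness_nonneg: "0 \<le> tightness"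
  using C_nonneg delta_nonneg by (simp add: tightness_def)

lemma near_optimal_excess:
  assumes "near_optimal x (is @ i # js) y" "x \<in> S" "y \<in> S"
  shows "excess x (p i) y \<le> tightness"
proof (cases js)
  case Nil
  then show ?thesis using near_optimal_last[of x "is" i y] assms delta_nonneg by (simp add: tightness_def)
next
  case (Cons j ks)
  have ij: "i \<in> J" "j \<in> J" using assms Cons by (auto simp: near_optimal_def)
  have 1: "near_optimal x (is @ [i]) (p j)"
    using near_optimal_split(1)[of x "is @ [i]" j ks y] assms Cons by simp
  have 2: "near_optimal (p i) (i # j # ks) y"
    using near_optimal_split(2)[of x "is" i js y] assms Cons by simp
  have 3: "near_optimal (p i) [i] (p j)"
    using near_optimal_split(1)[of "p i" "[i]" j ks y] 2 assms ij by simp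
  have "excess x (p i) y \<le> (2 * C + 1 + 2 * \<delta>) + 2 * \<delta>"
    by (rule excess_local_to_global(2)[of x "p i" "p j" y])
      (use near_optimal_last[OF 1] assms ij near_optimal_second[OF 2] near_optimal_one(1)[OF 3]
         long[OF ij(1)] C_nonneg delta_nonneg in auto)
  then show ?thesis by (simp add: tightness_def)
qed

text \<open>
  Cutting a nearly optimal route at any place into \<open>is\<close> and \<open>js\<close> gives consecutive waypoints
  \<open>a\<close> and \<open>b\<close>. Between them at most one shortcut is used, at a price at most \<open>C\<close> below its
  length.
\<close>
lemma near_optimal_waypoints:
  assumes opt: "near_optimal x (is @ js) y" and S: "x \<in> S" "y \<in> S"
  obtains a b where "a \<in> S" "b \<in> S" "excess x a y \<le> tightness" "excess x b y \<le> tightness"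
    "rdist x a + d a b + rdist b y \<le> rdist x y + C + 1"
    "a = (if is = [] then x else p (last is))" "b = (if js = [] then y else p (hd js))"
proof -
  define a where "a = (if is = [] then x else p (last is))"
  define b where "b = (if js = [] then y else p (hd js))"
  have J: "set is \<subseteq> J" "set js \<subseteq> J" using opt by (auto simp: near_optimal_def)
  have ab: "a \<in> S" "b \<in> S"
    using J S last_in_set[of "is"] hd_in_set[of js] by (auto simp: a_def b_def intro!: p_in)
  have ea: "excess x a y \<le> tightness"
  proof (cases "is" rule: rev_cases)
    case Nil then show ?thesis using S tightness_nonneg by (simp add: a_def)
  next
    case (snoc us u)
    then show ?thesis using near_optimal_excess[of x us u js y] opt S by (simp add: a_def)
  qed
  have eb: "excess x b y \<le> tightness"
  proof (cases js)
    case Nil then show ?thesis using S tightness_nonneg by (simp add: b_def)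
  next
    case (Cons v vs)
    then show ?thesis using near_optimal_excess[of x "is" v vs y] opt S by (simp add: b_def)
  qed
  have first: "rdist x a + d a b \<le> cost x is b + C" if "b \<in> S"
  proof (cases "is" rule: rev_cases)
    case Nil
    then show ?thesis using rdist_le[of x x] S C_nonneg by (simp add: a_def)
  next
    case (snoc us u)
    then have u: "u \<in> J" "us \<in> lists J" using J by auto
    show ?thesis
      using snoc cost_append[of x us u "[]" b] rdist_le_cost[OF u(2), of x "p u"] discount[OF u(1)]
        triangle[of "p u" "q u" b] u that by (simp add: a_def)
  qed
  have second: "cost x is b + rdist b y \<le> cost x (is @ js) y"
  proof (cases js)
    case Nil
    then show ?thesis using rdist_le[of y y] S by (simp add: b_def)
  next
    case (Cons v vs)
    then have "v # vs \<in> lists J" using J by auto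
    from rdist_le_cost[OF this, of "p v" y] show ?thesis
      using Cons cost_append[of x "is" v vs y] S \<open>v # vs \<in> lists J\<close> by (simp add: b_def)
  qed
  show thesis
    by (rule that[OF ab ea eb _ a_def b_def])
      (use first[OF ab(2)] second opt in \<open>simp add: near_optimal_def\<close>)
qed

text \<open>
  A point \<open>m\<close> near the geodesics from \<open>x\<close> to \<open>y\<close> lies roughly between two consecutive
  waypoints of a nearly optimal route. As all of these points are near the same geodesic,
  passing from one waypoint to the next through \<open>m\<close> is only boundedly longer.
\<close>
lemma rdist_almost_additive:
  assumes S: "x \<in> S" "y \<in> S" "m \<in> S" and m: "excess x m y \<le> tightness"
  shows "rdist x m + rdist m y \<le> rdist x y + C + 1 + 4 * tightness + 4 * \<delta>"
proof -
  obtain gs where opt: "near_optimal x gs y" by (rule near_optimal_exists)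
  \<comment> \<open>The route is cut where it becomes farther from \<open>x\<close> than \<open>m\<close> is.\<close>
  define P where "P i \<longleftrightarrow> d x (p i) \<le> d x m" for i
  define "is" where "is = takeWhile P gs"
  define js where "js = dropWhile P gs"
  have "near_optimal x (is @ js) y" using opt by (simp add: is_def js_def)
  then obtain a b where ab: "a \<in> S" "b \<in> S" "excess x a y \<le> tightness" "excess x b y \<le> tightness"
    "rdist x a + d a b + rdist b y \<le> rdist x y + C + 1"
    "a = (if is = [] then x else p (last is))" "b = (if js = [] then y else p (hd js))"
    using near_optimal_waypoints S by blast
  have 1: "d x a \<le> d x m"
  proof (cases "is = []")
    case False
    then have "P (last is)" unfolding is_def by (meson last_in_set set_takeWhileD)
    then show ?thesis using ab(6) False by (simp add: P_def)
  qed (use ab S in simp)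
  have 2: "d x m \<le> d x b + tightness"
  proof (cases "js = []")
    case False
    then have "\<not> P (hd js)" unfolding js_def by (rule hd_dropWhile)
    then show ?thesis using ab(7) False C_nonneg delta_nonneg by (simp add: P_def tightness_def)
  next
    case True
    then have "d x b = d x y" using ab(7) by simp
    then show ?thesis using m nonneg[of m y] unfolding excess_def by linarith
  qed
  have "rdist x m \<le> rdist x a + d a m" "rdist m y \<le> d m b + rdist b y"
    using rdist_triangle[OF S(1) ab(1) S(3)] rdist_le[of a m]
      rdist_triangle[OF S(3) ab(2) S(2)] rdist_le[of m b] by linarith+
  moreover have "d a m \<le> d x m - d x a + tightness + 2 * \<delta>"
    using dist_of_small_excess[OF S(1) ab(1) S(3,2) ab(3) m] 1 by linarith
  moreover have "d m b \<le> d x b - d x m + 3 * tightness + 2 * \<delta>"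
    using dist_of_small_excess[OF S(1,3) ab(2) S(2) m ab(4)] 2 tightness_nonneg by linarith
  moreover have "d x b \<le> d x a + d a b" using ab S by (intro triangle)
  ultimately show ?thesis using ab(5) by simp
qed

abbreviation "asymmetry \<equiv> route_asymmetry d J p q c"

text \<open>
  Cutting all three sides at the centre \<open>m\<close> of the triangle, the asymmetry of \<open>x\<close> and \<open>y\<close>
  becomes the difference of the asymmetries of \<open>x\<close> and \<open>m\<close> and of \<open>y\<close> and \<open>m\<close>, up to a
  constant.
\<close>
lemma asymmetry_quasi_additive:
  assumes geo: "geodesic_space S d" and S: "x \<in> S" "y \<in> S" "z \<in> S"
  shows "\<bar>asymmetry x z - asymmetry x y - asymmetry y z\<bar> \<le> 27 * C + 60 * \<delta> + 15"
proof -
  obtain m where m: "m \<in> S" "excess x m y \<le> 2 * \<delta>" "excess y m z \<le> 2 * \<delta>" "excess x m z \<le> 2 * \<delta>"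
    using exists_centre[OF geo S] by blast
  have *: "\<bar>asymmetry u v - asymmetry u m + asymmetry v m\<bar> \<le> C + 1 + 4 * tightness + 4 * \<delta>"
    if "u \<in> S" "v \<in> S" "excess u m v \<le> 2 * \<delta>" for u v
  proof -
    have e: "excess u m v \<le> tightness" "excess v m u \<le> tightness"
      using that C_nonneg delta_nonneg by (auto simp: tightness_def excess_commute[of v])
    show ?thesis
      using rdist_almost_additive[OF that(1,2) m(1) e(1)] rdist_almost_additive[OF that(2,1) m(1) e(2)]
        rdist_triangle[OF that(1) m(1) that(2)] rdist_triangle[OF that(2) m(1) that(1)]
      by (simp add: route_asymmetry_def)
  qed
  have three: "\<bar>u - v - w\<bar> \<le> 3 * K" if "\<bar>u\<bar> \<le> K" "\<bar>v\<bar> \<le> K" "\<bar>w\<bar> \<le> K" for u v w K :: real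
    using that by linarith
  show ?thesis
    using three[OF *[OF S(1,3) m(4)] *[OF S(1,2) m(2)] *[OF S(2,3) m(3)]] by (simp add: tightness_def)
qed

text \<open>
  A nearly optimal route traverses a whole shortcut along geodesics between its endpoints,
  in the direction of travel.
\<close>
lemma near_optimal_passes:
  assumes opt: "near_optimal x (is @ i # js) y" and S: "x \<in> S" "y \<in> S"
  shows "d x (p i) + d (p i) (q i) + d (q i) y \<le> d x y + (5 * C + 6 * \<delta> + 3)"
proof -
  have J: "i \<in> J" "set js \<subseteq> J" using opt by (auto simp: near_optimal_def)
  define b where "b = (if js = [] then y else p (hd js))"
  have b: "b \<in> S" using J S hd_in_set[of js] by (auto simp: b_def intro!: p_in)
  have to_b: "near_optimal x (is @ [i]) b" "excess x b y \<le> tightness"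
  proof -
    show "near_optimal x (is @ [i]) b"
      using opt near_optimal_split(1)[of x "is @ [i]" "hd js" "tl js" y] S by (cases js) (auto simp: b_def)
    show "excess x b y \<le> tightness"
      using opt near_optimal_excess[of x "is @ [i]" "hd js" "tl js" y] S tightness_nonneg
      by (cases js) (auto simp: b_def)
  qed
  have "excess x (p i) b \<le> 2 * C + 1 + 2 * \<delta>" using near_optimal_last[OF to_b(1) S(1) b] .
  moreover have "excess (p i) (q i) b \<le> C + 1"
    using near_optimal_one(2)[OF near_optimal_split(2)[OF to_b(1) S(1) b] b] .
  moreover have "d (q i) y \<le> d (q i) b + d b y" using J(1) b S by (intro triangle) auto
  ultimately show ?thesis using to_b(2) unfolding excess_def tightness_def by linarith
qed

end

section \<open>Loxodromic elements and their axes\<close>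

locale isometric_group = hyperbolic_metric S d \<delta> + group G
  for S :: "'s set" and d :: "'s \<Rightarrow> 's \<Rightarrow> real" and \<delta> :: real
    and G :: "('g, 'm) monoid_scheme" (structure) +
  fixes \<phi> :: "'g \<Rightarrow> 's \<Rightarrow> 's" and x0 :: 's
  assumes action: "group_action G S \<phi>"
    and isometry: "\<lbrakk>g \<in> carrier G; x \<in> S; y \<in> S\<rbrakk> \<Longrightarrow> d (\<phi> g x) (\<phi> g y) = d x y"
    and basepoint [simp]: "x0 \<in> S"
begin

definition pt :: "'g \<Rightarrow> 's" where "pt g = \<phi> g x0"

definition len :: "'g \<Rightarrow> real" where "len g = d x0 (pt g)"

lemma action_closed [simp]: "g \<in> carrier G \<Longrightarrow> x \<in> S \<Longrightarrow> \<phi> g x \<in> S"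
  using group_action.element_image[OF action] by blast

lemma pt_in [simp]: "g \<in> carrier G \<Longrightarrow> pt g \<in> S"
  by (simp add: pt_def)

lemma pt_one [simp]: "pt \<one> = x0"
  using group_action.id_eq_one[OF action] basepoint by (metis pt_def id_apply restrict_apply)

lemma action_pt: "\<lbrakk>g \<in> carrier G; h \<in> carrier G\<rbrakk> \<Longrightarrow> \<phi> g (pt h) = pt (g \<otimes> h)"
  using group_action.composition_rule[OF action basepoint] by (simp add: pt_def)

lemma dist_translate [simp]:
  "\<lbrakk>g \<in> carrier G; h \<in> carrier G; k \<in> carrier G\<rbrakk> \<Longrightarrow> d (pt (g \<otimes> h)) (pt (g \<otimes> k)) = d (pt h) (pt k)"
  using isometry[of g "pt h" "pt k"] by (simp add: action_pt)

lemma dist_pt: "\<lbrakk>g \<in> carrier G; h \<in> carrier G\<rbrakk> \<Longrightarrow> d (pt g) (pt h) = len (inv g \<otimes> h)"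
  using dist_translate[of "inv g" g h] by (simp add: len_def)

lemma len_inv [simp]: "g \<in> carrier G \<Longrightarrow> len (inv g) = len g"
  using dist_pt[of g \<one>] by (simp add: len_def commute)

text \<open>
  If \<open>len (w \<otimes> w)\<close> is barely larger than \<open>len w\<close>, then \<open>w\<close> and its inverse move \<open>x0\<close> in the
  same direction for half of their length. If this held for all \<open>w\<close>, then in particular for
  elements \<open>g\<close> and \<open>h\<close> that move \<open>x0\<close> far in different directions. The inverse of \<open>g\<close> then
  also moves \<open>x0\<close> in a direction different from \<open>h\<close>, so that the product \<open>g \<otimes> h\<close> moves \<open>x0\<close>
  first in the direction of \<open>g\<close> and its inverse moves \<open>x0\<close> first in the direction of \<open>h\<close>;
  these are different, a contradiction.
\<close>
lemma exists_loxodromic: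
  assumes ends: "\<And>R. \<exists>g\<in>carrier G. \<exists>h\<in>carrier G. R \<le> len g \<and> R \<le> len h \<and> excess (pt g) x0 (pt h) \<le> B"
    and "0 \<le> B" "0 \<le> T"
  shows "\<exists>w\<in>carrier G. len w + T \<le> len (w \<otimes> w)"
proof (rule ccontr)
  assume no: "\<not> ?thesis"
  \<comment> \<open>Lengths this large rule out the unwanted alternatives of the four-point inequality below.\<close>
  define R where "R = 2 * B + 8 * \<delta> + T + 1"
  obtain g h where gh: "g \<in> carrier G" "h \<in> carrier G" "R \<le> len g" "R \<le> len h"
    "excess (pt g) x0 (pt h) \<le> B"
    using ends by blast
  have square: "d (pt g') (pt (inv g')) < len g' + T" if "g' \<in> carrier G" for g'
    using no that dist_pt[of "inv g'" g'] by (auto simp: commute not_le)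
  have l: "d x0 (pt g') = len g'" "d (pt g') x0 = len g'" for g'
    by (simp_all add: len_def commute)
  have B: "len g + len h - B \<le> d (pt g) (pt h)"
    using gh(5) by (simp add: excess_def l)
  have 1: "len g + len h - B - 2 * \<delta> \<le> d (pt (inv g)) (pt h)"
    using four_point[of x0 "pt g" "pt (inv g)" "pt h"] four_point[of x0 "pt (inv g)" "pt g" "pt h"]
      four_point[of x0 "pt g" "pt h" "pt (inv g)"] square[OF gh(1)] B gh(1-4) assms(2,3) delta_nonneg
    by (auto simp: l R_def commute max_def split: if_splits)
  have 2: "len g + len h - B - 2 * \<delta> \<le> d (pt g) (pt (inv h))"
    using four_point[of x0 "pt h" "pt (inv h)" "pt g"] four_point[of x0 "pt (inv h)" "pt h" "pt g"]
      four_point[of x0 "pt h" "pt g" "pt (inv h)"] square[OF gh(2)] B gh(1-4) assms(2,3) delta_nonneg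
    by (auto simp: l R_def commute max_def split: if_splits)
  define k where "k = g \<otimes> h"
  have k: "k \<in> carrier G" using gh by (simp add: k_def)
  have lenk: "len k = d (pt (inv g)) (pt h)"
    using gh dist_pt[of "inv g" h] by (simp add: k_def)
  have gk: "d (pt g) (pt k) = len h"
    using dist_translate[of g \<one> h] gh by (simp add: k_def l)
  have hk: "d (pt (inv h)) (pt (inv k)) = len g"
    using dist_translate[of "inv h" \<one> "inv g"] gh by (simp add: k_def l inv_mult_group)
  have 3: "len g + 2 * len h - 2 * B - 6 * \<delta> \<le> d (pt k) (pt (inv h))"
    using four_point[of x0 "pt g" "pt k" "pt (inv h)"] 1 2 gk lenk gh(1-4) k assms(2,3) delta_nonneg
    by (auto simp: l R_def max_def split: if_splits)
  have 4: "len g + len h + len k - 2 * B - 8 * \<delta> \<le> d (pt k) (pt (inv k))"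
    using four_point[of x0 "pt k" "pt (inv k)" "pt (inv h)"] 3 hk gh(1-4) k assms(2,3) delta_nonneg
    by (auto simp: l R_def commute max_def split: if_splits)
  then show False using square[OF k] gh(3,4) assms(2,3) delta_nonneg unfolding R_def by linarith
qed

text \<open>
  The orbit of \<open>x0\<close> under \<open>w\<close> is a chain with long steps and small local detours, hence a
  quasi-geodesic, and lengths of powers are additive up to a constant.
\<close>
lemma loxodromic_orbit:
  assumes w: "w \<in> carrier G" and T: "len w + (4 * \<delta> + 1) \<le> len (w \<otimes> w)"
  obtains a where "0 \<le> a" "\<And>i j :: nat. len (w [^] i) + len (w [^] j) \<le> len (w [^] (i + j)) + a"
    "\<And>n :: nat. real n \<le> len (w [^] n)"
proof -
  define f where "f n = len (w [^] (n :: nat))" for n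
  define P where "P n = pt (w [^] (n :: nat))" for n
  \<comment> \<open>The excess at each point of the orbit with respect to its two neighbours.\<close>
  define e where "e = 2 * f 1 - f 2"
  have dist: "d (P i) (P (i + j)) = f j" for i j :: nat
    using dist_translate[of "w [^] i" \<one> "w [^] j"] w by (simp add: f_def P_def len_def nat_pow_mult)
  have dist0: "d x0 (P j) = f j" for j :: nat by (simp add: f_def P_def len_def)
  have "f 1 + 4 * \<delta> + 1 \<le> f 2"
    using T w by (simp add: f_def numeral_2_eq_2)
  then have e: "e + 4 * \<delta> + 1 \<le> f 1" by (simp add: e_def)
  have S: "P i \<in> S" for i :: nat using w by (simp add: P_def)
  have e0: "0 \<le> e"
    using excess_nonneg[OF basepoint S[of 1] S[of "1 + 1"]] unfolding excess_def dist0 dist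
    unfolding e_def one_add_one by linarith
  have step: "f m + f 1 - f (m + 1) \<le> e + 2 * \<delta>" for m
  proof (induction m)
    case 0 then show ?case using e0 delta_nonneg by (simp add: f_def len_def)
  next
    case (Suc m)
    have "excess x0 (P (m + 1)) (P (m + 2)) \<le> e + 2 * \<delta>"
      by (rule excess_local_to_global(1)[of x0 "P m" _ _ "e + 2 * \<delta>"])
        (use S Suc e e0 delta_nonneg dist[of m 1] dist[of m 2] dist[of "m + 1" 1] in
          \<open>auto simp: excess_def dist0 e_def\<close>)
    then show ?case using dist[of "m + 1" 1] by (simp add: excess_def dist0)
  qed
  have add: "f i + f j \<le> f (i + j) + (e + 4 * \<delta>)" for i j
  proof (cases j)
    case 0 then show ?thesis using e0 delta_nonneg by (simp add: f_def len_def)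
  next
    case (Suc m)
    have "excess x0 (P i) (P (i + j)) \<le> (e + 2 * \<delta>) + 2 * \<delta>"
      by (rule excess_local_to_global(2)[of x0 _ "P (i + 1)" _ _ "e + 2 * \<delta>"])
        (use S Suc e e0 delta_nonneg step[of i] step[of m] dist[of i 1] dist[of i j] dist[of "i + 1" m] in
          \<open>auto simp: excess_def dist0 add.commute\<close>)
    then show ?thesis using dist[of i j] by (simp add: excess_def dist0)
  qed
  have "real n \<le> f n" for n
  proof (induction n)
    case 0 then show ?case by (simp add: f_def len_def)
  next
    case (Suc n) then show ?case using add[of n 1] e by simp
  qed
  then show thesis using that[of "e + 4 * \<delta>"] add e0 delta_nonneg by (simp add: f_def)
qed

lemma route_cost_translate:
  assumes s: "s \<in> carrier G" and v: "v \<in> carrier G"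
  shows "x \<in> S \<Longrightarrow> y \<in> S \<Longrightarrow> gs \<in> lists (carrier G) \<Longrightarrow>
    route_cost d pt (\<lambda>g. pt (g \<otimes> v)) c (\<phi> s x) (map (\<lambda>g. s \<otimes> g) gs) (\<phi> s y) =
    route_cost d pt (\<lambda>g. pt (g \<otimes> v)) (\<lambda>g. c (s \<otimes> g)) x gs y"
proof (induction gs arbitrary: x)
  case Nil
  then show ?case using s by (simp add: isometry)
next
  case (Cons g gs)
  then have "d (\<phi> s x) (pt (s \<otimes> g)) = d x (pt g)" "pt (s \<otimes> g \<otimes> v) = \<phi> s (pt (g \<otimes> v))"
    using s v isometry[OF s, of x "pt g"] by (simp_all add: action_pt m_assoc)
  then show ?case using Cons v by simp
qed

lemma route_dist_translate:
  assumes s: "s \<in> carrier G" and v: "v \<in> carrier G" and S: "x \<in> S" "y \<in> S"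
  shows "route_dist d (carrier G) pt (\<lambda>g. pt (g \<otimes> v)) c (\<phi> s x) (\<phi> s y) =
    route_dist d (carrier G) pt (\<lambda>g. pt (g \<otimes> v)) (\<lambda>g. c (s \<otimes> g)) x y"
proof -
  have "(\<lambda>g. s \<otimes> g) ` carrier G = carrier G"
    by (rule surj_const_mult[OF s])
  then have lists: "lists (carrier G) = map (\<lambda>g. s \<otimes> g) ` lists (carrier G)"
    by (metis lists_image)
  show ?thesis
    unfolding route_dist_def
    by (subst lists) (use assms in \<open>auto simp: image_comp route_cost_translate intro!: arg_cong[where f = Inf] image_cong\<close>)
qed

end

locale loxodromic = isometric_group S d \<delta> G \<phi> x0
  for S :: "'s set" and d :: "'s \<Rightarrow> 's \<Rightarrow> real" and \<delta> :: real
    and G :: "('g, 'm) monoid_scheme" (structure) and \<phi> :: "'g \<Rightarrow> 's \<Rightarrow> 's" and x0 :: 's +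
  fixes w :: 'g and a :: real
  assumes w_in [simp]: "w \<in> carrier G" and a_nonneg: "0 \<le> a"
    and len_pow_add: "len (w [^] (i :: nat)) + len (w [^] (j :: nat)) \<le> len (w [^] (i + j)) + a"
    and len_pow_ge: "real n \<le> len (w [^] (n :: nat))"
begin

abbreviation f :: "nat \<Rightarrow> real" where "f n \<equiv> len (w [^] n)"

lemma dist_pow: "d (pt (w [^] i)) (pt (w [^] (i + j))) = f j" for i j :: nat
  using dist_translate[of "w [^] i" \<one> "w [^] j"] by (simp add: len_def nat_pow_mult)

lemma dist_pow': "g \<in> carrier G \<Longrightarrow> d (pt (g \<otimes> w [^] i)) (pt (g \<otimes> w [^] (i + j))) = f j" for i j :: nat
  by (simp add: dist_pow)

lemma len_pow_subadd: "f (i + j) \<le> f i + f j"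
  using triangle[of x0 "pt (w [^] i)" "pt (w [^] (i + j))"] dist_pow[of i j] by (simp add: len_def)

lemma len_pow_mult: "real n * (f k - a) \<le> f (n * k)"
proof (induction n)
  case (Suc n)
  then show ?case using len_pow_add[of k "n * k"] by (simp add: algebra_simps)
qed (simp add: len_def)

definition matching_bound :: "real \<Rightarrow> real" where
  "matching_bound b = f 1 + 4 * a + 2 * b + 2 * \<delta>"

text \<open>
  The hypothesis says that the translate by \<open>g\<close> of the orbit segment from \<open>x0\<close> to the \<open>k\<close>-th
  power lies along the axis between \<open>pt (w [^] m)\<close> and \<open>x0\<close> and runs backwards, towards
  \<open>x0\<close>. Points near a common geodesic are close when their distances to one end are close,
  and lengths of powers are almost additive; so a single shift \<open>j\<close> matches the whole segment
  with the axis. The bound does not depend on \<open>k\<close>.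
\<close>
lemma reversed_segment_matches_axis:
  assumes g: "g \<in> carrier G"
    and near: "d (pt (w [^] (m :: nat))) (pt g) + f k + d (pt (g \<otimes> w [^] k)) x0 \<le> d (pt (w [^] m)) x0 + b"
  obtains j where "\<And>r. r \<le> k \<Longrightarrow> d (pt (w [^] (j + r))) (pt (g \<otimes> w [^] (k - r))) \<le> matching_bound b"
proof -
  define Y where "Y = pt (w [^] m)"
  define E where "E = d (pt (g \<otimes> w [^] k)) x0"
  have E: "0 \<le> E" by (simp add: E_def)
  have "E \<le> f (nat \<lceil>E\<rceil>)" using len_pow_ge[of "nat \<lceil>E\<rceil>"] E by linarith
  \<comment> \<open>The power of \<open>w\<close> that matches the end of the segment, where the axis first gets as far from
    \<open>x0\<close> as the end of the segment is.\<close>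
  define j where "j = (LEAST j. E \<le> f j)"
  have j1: "E \<le> f j" unfolding j_def using \<open>E \<le> f (nat \<lceil>E\<rceil>)\<close> by (rule LeastI)
  have j2: "f j \<le> E + f 1"
  proof (cases j)
    case 0 then show ?thesis using E len_pow_ge[of 1] by (simp add: len_def)
  next
    case (Suc i)
    then have "f i < E" using not_less_Least[of i "\<lambda>j. E \<le> f j"] by (simp add: j_def)
    then show ?thesis using len_pow_subadd[of i 1] Suc by simp
  qed
  have b: "0 \<le> b"
  proof -
    have in_S: "Y \<in> S" by (simp add: Y_def)
    have "d Y x0 \<le> d Y (pt g) + (d (pt g) (pt (g \<otimes> w [^] k)) + E)"
      using triangle[of Y "pt g" x0] triangle[of "pt g" "pt (g \<otimes> w [^] k)" x0] g in_S by (simp add: E_def)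
    then show ?thesis using near dist_pow'[OF g, of 0 k] g by (simp add: Y_def E_def)
  qed
  have "d (pt (w [^] (j + r))) (pt (g \<otimes> w [^] (k - r))) \<le> matching_bound b" if r: "r \<le> k" for r
  proof -
    define z where "z = pt (g \<otimes> w [^] (k - r))"
    define v where "v = pt (w [^] (j + r))"
    \<comment> \<open>The matching powers may lie beyond \<open>Y\<close>, so the axis is extended.\<close>
    define Y' where "Y' = pt (w [^] (m + (j + k)))"
    have in_S: "z \<in> S" "v \<in> S" "Y \<in> S" "Y' \<in> S" using g by (auto simp: z_def v_def Y_def Y'_def)
    have gz: "d (pt g) z = f (k - r)" using dist_pow'[OF g, of 0 "k - r"] g by (simp add: z_def)
    have zk: "d z (pt (g \<otimes> w [^] k)) = f r"
      using dist_pow'[OF g, of "k - r" r] r by (simp add: z_def)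
    have Yz: "d Y z \<le> d Y (pt g) + f (k - r)" and zx: "d z x0 \<le> f r + E"
      using triangle[of Y "pt g" z] triangle[of z "pt (g \<otimes> w [^] k)" x0] in_S g
      by (auto simp: gz zk E_def)
    have fk: "f (k - r) + f r \<le> f k + a" "f k \<le> f (k - r) + f r"
      using len_pow_add[of "k - r" r] len_pow_subadd[of "k - r" r] r by auto
    have sum: "d Y z + d z x0 \<le> d Y x0 + b + a" using Yz zx near fk by (simp add: Y_def E_def)
    have zx_ge: "E + f r - a - b \<le> d z x0"
      using triangle[of Y z x0] in_S Yz near fk by (simp add: Y_def E_def)
    have vx: "d x0 v = f (j + r)" by (simp add: v_def len_def)
    have fj: "f j + f r \<le> f (j + r) + a" "f (j + r) \<le> f j + f r"
      using len_pow_add[of j r] len_pow_subadd[of j r] by auto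
    have YY: "d Y Y' = f (j + k)" using dist_pow[of m "j + k"] by (simp add: Y_def Y'_def)
    have Yx: "d Y x0 = f m" "d x0 Y' = f (m + (j + k))" by (auto simp: Y_def Y'_def len_def commute)
    have "excess x0 z Y' \<le> b + 2 * a"
    proof -
      have "d z Y' \<le> d Y z + d Y Y'" using triangle[of z Y Y'] in_S by (simp add: commute)
      then show ?thesis using sum YY Yx len_pow_add[of m "j + k"]
        by (simp add: excess_def commute[of z x0])
    qed
    moreover have "excess x0 v Y' \<le> b + 2 * a"
    proof -
      have "d v Y' = f (m + (k - r))"
        using dist_pow[of "j + r" "m + (k - r)"] r by (simp add: v_def Y'_def algebra_simps)
      then show ?thesis using vx Yx len_pow_add[of "j + r" "m + (k - r)"] r a_nonneg b
        by (simp add: excess_def algebra_simps)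
    qed
    ultimately have "d v z \<le> \<bar>d x0 v - d x0 z\<bar> + (b + 2 * a) + 2 * \<delta>"
      using dist_of_small_excess[of x0 v z Y'] in_S by simp
    moreover have "\<bar>d x0 v - d x0 z\<bar> \<le> f 1 + 2 * a + b"
      using vx fj zx zx_ge j1 j2 a_nonneg b len_pow_ge[of 1] commute[of x0 z] by (simp add: abs_le_iff)
    ultimately show ?thesis by (simp add: matching_bound_def v_def z_def)
  qed
  then show thesis using that by blast
qed

definition reversing :: "'g set" where
  "reversing = {g \<in> carrier G. \<exists>r > (0::nat). g \<otimes> w [^] r \<otimes> inv g = inv (w [^] r)}"

text \<open>
  The elements \<open>u i = g \<otimes> w [^] i \<otimes> inv g \<otimes> w [^] i\<close> go forward along the axis by \<open>w [^] i\<close>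
  and then back by its conjugate, so they move the points of a long piece of the axis by a
  bounded amount. By acylindricity two of them agree, and \<open>u i = u i'\<close> says that \<open>g\<close>
  conjugates \<open>w [^] (i' - i)\<close> to its inverse.
\<close>
lemma reversed_segment_reverses_axis:
  assumes acyl: "acylindrical_action G S d \<phi>" and b: "0 \<le> b"
  shows "\<exists>k0. \<forall>k\<ge>k0. \<forall>m :: nat. \<forall>g\<in>carrier G.
    d (pt (w [^] m)) (pt g) + f k + d (pt (g \<otimes> w [^] k)) x0 \<le> d (pt (w [^] m)) x0 + b \<longrightarrow> g \<in> reversing"
proof -
  define \<epsilon> where "\<epsilon> = 2 * matching_bound b"
  have "\<epsilon> > 0" using len_pow_ge[of 1] a_nonneg b delta_nonneg by (simp add: \<epsilon>_def matching_bound_def)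
  then have "\<exists>R>0. \<exists>N>(0::nat). \<forall>x\<in>S. \<forall>y\<in>S. d x y \<ge> R \<longrightarrow>
        finite {s \<in> carrier G. d x (\<phi> s x) \<le> \<epsilon> \<and> d y (\<phi> s y) \<le> \<epsilon>} \<and>
        card {s \<in> carrier G. d x (\<phi> s x) \<le> \<epsilon> \<and> d y (\<phi> s y) \<le> \<epsilon>} \<le> N"
    using acyl unfolding acylindrical_action_def by blast
  then obtain R N where RN: "R > 0" "\<And>x y. \<lbrakk>x \<in> S; y \<in> S; d x y \<ge> R\<rbrakk> \<Longrightarrow>
        finite {s \<in> carrier G. d x (\<phi> s x) \<le> \<epsilon> \<and> d y (\<phi> s y) \<le> \<epsilon>} \<and>
        card {s \<in> carrier G. d x (\<phi> s x) \<le> \<epsilon> \<and> d y (\<phi> s y) \<le> \<epsilon>} \<le> (N :: nat)"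
    by blast
  define \<rho> where "\<rho> = nat \<lceil>R\<rceil>"
  have \<rho>: "R \<le> f \<rho>" using len_pow_ge[of \<rho>] RN(1) unfolding \<rho>_def by linarith
  have "g \<in> reversing"
    if k: "k \<ge> N + \<rho>" and g: "g \<in> carrier G"
      and near: "d (pt (w [^] (m :: nat))) (pt g) + f k + d (pt (g \<otimes> w [^] k)) x0 \<le> d (pt (w [^] m)) x0 + b"
    for k m g
  proof -
    obtain j where j: "\<And>r. r \<le> k \<Longrightarrow> d (pt (w [^] (j + r))) (pt (g \<otimes> w [^] (k - r))) \<le> matching_bound b"
      using reversed_segment_matches_axis[OF g near] by blast
    define u where "u i = g \<otimes> w [^] i \<otimes> inv g \<otimes> w [^] i" for i :: nat
    have u_in: "u i \<in> carrier G" for i using g by (simp add: u_def)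
    have moves: "d (pt (w [^] (j + r))) (\<phi> (u i) (pt (w [^] (j + r)))) \<le> \<epsilon>" if "r + i \<le> k" for r i
    proof -
      have cancel: "inv g \<otimes> (g \<otimes> x) = x" if "x \<in> carrier G" for x
        using g that by (simp flip: m_assoc)
      have c: "g \<otimes> w [^] i \<otimes> inv g \<in> carrier G" using g by simp
      have "g \<otimes> w [^] i \<otimes> inv g \<otimes> (g \<otimes> w [^] (k - (r + i))) = g \<otimes> (w [^] i \<otimes> w [^] (k - (r + i)))"
        using g cancel by (simp add: m_assoc)
      also have "w [^] i \<otimes> w [^] (k - (r + i)) = w [^] (k - r)"
        using that by (simp add: nat_pow_mult)
      finally have 1: "g \<otimes> w [^] i \<otimes> inv g \<otimes> (g \<otimes> w [^] (k - (r + i))) = g \<otimes> w [^] (k - r)" .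
      have "\<phi> (u i) (pt (w [^] (j + r))) = pt (g \<otimes> w [^] i \<otimes> inv g \<otimes> (w [^] i \<otimes> w [^] (j + r)))"
        using g u_in by (simp add: action_pt u_def m_assoc)
      also have "w [^] i \<otimes> w [^] (j + r) = w [^] (j + (r + i))" by (simp add: nat_pow_mult add_ac)
      finally have 2: "\<phi> (u i) (pt (w [^] (j + r))) = pt (g \<otimes> w [^] i \<otimes> inv g \<otimes> w [^] (j + (r + i)))" .
      have "d (pt (g \<otimes> w [^] (k - r))) (\<phi> (u i) (pt (w [^] (j + r)))) \<le> matching_bound b"
        using dist_translate[OF c, of "g \<otimes> w [^] (k - (r + i))" "w [^] (j + (r + i))"] j[OF that] g
        unfolding 1 2 by (simp add: commute)
      moreover have "d (pt (w [^] (j + r))) (pt (g \<otimes> w [^] (k - r))) \<le> matching_bound b"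
        using j that by simp
      moreover have "d (pt (w [^] (j + r))) (\<phi> (u i) (pt (w [^] (j + r))))
          \<le> d (pt (w [^] (j + r))) (pt (g \<otimes> w [^] (k - r)))
            + d (pt (g \<otimes> w [^] (k - r))) (\<phi> (u i) (pt (w [^] (j + r))))"
        using g u_in by (intro triangle) auto
      ultimately show ?thesis by (simp add: \<epsilon>_def)
    qed
    define A where "A = {s \<in> carrier G. d (pt (w [^] j)) (\<phi> s (pt (w [^] j))) \<le> \<epsilon>
        \<and> d (pt (w [^] (j + \<rho>))) (\<phi> s (pt (w [^] (j + \<rho>)))) \<le> \<epsilon>}"
    have A: "finite A" "card A \<le> N"
      using RN(2)[of "pt (w [^] j)" "pt (w [^] (j + \<rho>))"] \<rho> dist_pow[of j \<rho>] by (simp_all add: A_def)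
    have "u ` {..N} \<subseteq> A"
    proof
      fix s assume "s \<in> u ` {..N}"
      then obtain i where "s = u i" "i \<le> N" by auto
      then show "s \<in> A" using moves[of 0 i] moves[of \<rho> i] k u_in by (simp add: A_def)
    qed
    then have "card (u ` {..N}) \<le> N" using A(2) card_mono[OF A(1)] le_trans by blast
    then have "\<not> inj_on u {..N}" using card_image[of u "{..N}"] by auto
    then have "\<exists>i i'. i < i' \<and> u i = u i'" unfolding inj_on_def by (metis nat_neq_iff)
    then obtain i i' where ii: "i < i'" "u i = u i'" by blast
    define r where "r = i' - i"
    have i': "w [^] i' = w [^] i \<otimes> w [^] r" "w [^] i' = w [^] r \<otimes> w [^] i"
      using ii(1) by (simp_all add: r_def nat_pow_mult)
    have "g \<otimes> w [^] i \<otimes> (inv g \<otimes> w [^] i) = u i" using g by (simp add: u_def m_assoc)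
    also note ii(2)
    also have "u i' = g \<otimes> (w [^] i \<otimes> w [^] r) \<otimes> inv g \<otimes> (w [^] r \<otimes> w [^] i)"
      unfolding u_def by (simp only: i'[symmetric])
    also have "\<dots> = g \<otimes> w [^] i \<otimes> (w [^] r \<otimes> inv g \<otimes> w [^] r \<otimes> w [^] i)"
      using g by (simp add: m_assoc)
    finally have "inv g \<otimes> w [^] i = w [^] r \<otimes> inv g \<otimes> w [^] r \<otimes> w [^] i" using g by simp
    then have "inv g = w [^] r \<otimes> inv g \<otimes> w [^] r" using g by simp
    then have "g \<otimes> inv g = g \<otimes> w [^] r \<otimes> inv g \<otimes> w [^] r" using g by (simp add: m_assoc)
    then have "g \<otimes> w [^] r \<otimes> inv g \<otimes> w [^] r = \<one>" using g by simp
    then have "g \<otimes> w [^] r \<otimes> inv g = inv (w [^] r)" using g by (intro inv_equality[symmetric]) auto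
    moreover have "0 < r" using ii(1) by (simp add: r_def)
    ultimately show ?thesis using g unfolding reversing_def by blast
  qed
  then show ?thesis by blast
qed

text \<open>
  The elements \<open>h\<close> for which the translates by \<open>g\<close> and \<open>h\<close> of the axis of \<open>w\<close> are parallel
  and have the same direction. This is detected by conjugates of powers of \<open>w\<close>; using powers
  identifies, for example, translates by elements that centralise only a power of \<open>w\<close>.
\<close>
definition axis_class :: "'g \<Rightarrow> 'g set" where
  "axis_class g = {h \<in> carrier G. \<exists>r > (0::nat). g \<otimes> w [^] r \<otimes> inv g = h \<otimes> w [^] r \<otimes> inv h}"

lemma conj_pow:
  fixes r n :: nat
  assumes g: "g \<in> carrier G"
  shows "(g \<otimes> w [^] r \<otimes> inv g) [^] n = g \<otimes> w [^] (r * n) \<otimes> inv g"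
proof (induction n)
  case 0 then show ?case using g by simp
next
  case (Suc n)
  have cancel: "inv g \<otimes> (g \<otimes> x) = x" if "x \<in> carrier G" for x
    using g that by (simp flip: m_assoc)
  have "(g \<otimes> w [^] r \<otimes> inv g) [^] Suc n = g \<otimes> (w [^] (r * n) \<otimes> w [^] r) \<otimes> inv g"
    using g Suc cancel by (simp add: m_assoc)
  then show ?case by (simp add: nat_pow_mult add.commute)
qed

lemma axis_class_self: "g \<in> carrier G \<Longrightarrow> g \<in> axis_class g"
  by (auto simp: axis_class_def)

lemma axis_class_subset:
  assumes gh: "g \<in> carrier G" "h \<in> carrier G" and r: "r > (0::nat)"
    and eq: "g \<otimes> w [^] r \<otimes> inv g = h \<otimes> w [^] r \<otimes> inv h"
  shows "axis_class g \<subseteq> axis_class h"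
proof
  fix x assume "x \<in> axis_class g"
  then obtain r' :: nat where x: "x \<in> carrier G" "r' > 0" "g \<otimes> w [^] r' \<otimes> inv g = x \<otimes> w [^] r' \<otimes> inv x"
    by (auto simp: axis_class_def)
  have "h \<otimes> w [^] (r * r') \<otimes> inv h = (h \<otimes> w [^] r \<otimes> inv h) [^] r'" using gh by (simp add: conj_pow)
  also have "\<dots> = (g \<otimes> w [^] r' \<otimes> inv g) [^] r" using gh by (simp add: conj_pow mult.commute flip: eq)
  also have "\<dots> = x \<otimes> w [^] (r * r') \<otimes> inv x" using x by (simp add: conj_pow mult.commute)
  finally show "x \<in> axis_class h" using x r by (auto simp: axis_class_def intro!: exI[of _ "r * r'"])
qed

lemma axis_class_eq:
  assumes "g \<in> carrier G" "h \<in> carrier G" "r > (0::nat)" "g \<otimes> w [^] r \<otimes> inv g = h \<otimes> w [^] r \<otimes> inv h"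
  shows "axis_class g = axis_class h"
  using axis_class_subset[OF assms] axis_class_subset[OF assms(2,1,3) assms(4)[symmetric]] by simp

lemma axis_class_translate_subset:
  assumes s: "s \<in> carrier G" and g: "g \<in> carrier G"
  shows "(\<lambda>x. s \<otimes> x) ` axis_class g \<subseteq> axis_class (s \<otimes> g)"
proof
  fix y assume "y \<in> (\<lambda>x. s \<otimes> x) ` axis_class g"
  then obtain x r where x: "x \<in> carrier G" "y = s \<otimes> x" "r > (0::nat)"
    "g \<otimes> w [^] r \<otimes> inv g = x \<otimes> w [^] r \<otimes> inv x"
    by (auto simp: axis_class_def)
  have conj: "s \<otimes> z \<otimes> w [^] r \<otimes> inv (s \<otimes> z) = s \<otimes> (z \<otimes> w [^] r \<otimes> inv z) \<otimes> inv s" if "z \<in> carrier G" for z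
    using s that by (simp add: inv_mult_group m_assoc)
  show "y \<in> axis_class (s \<otimes> g)"
    using x s g conj[OF g] conj[OF x(1)] by (auto simp: axis_class_def)
qed

lemma axis_class_translate:
  assumes s: "s \<in> carrier G" and g: "g \<in> carrier G"
  shows "(\<lambda>x. s \<otimes> x) ` axis_class g = axis_class (s \<otimes> g)"
proof
  show "axis_class (s \<otimes> g) \<subseteq> (\<lambda>x. s \<otimes> x) ` axis_class g"
  proof
    fix y assume y: "y \<in> axis_class (s \<otimes> g)"
    then have "y \<in> carrier G" by (simp add: axis_class_def)
    moreover have "inv s \<otimes> y \<in> axis_class (inv s \<otimes> (s \<otimes> g))"
      using axis_class_translate_subset[of "inv s" "s \<otimes> g"] y s g by auto
    ultimately show "y \<in> (\<lambda>x. s \<otimes> x) ` axis_class g"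
      using s g by (intro image_eqI[of _ _ "inv s \<otimes> y"]) (simp_all flip: m_assoc)
  qed
qed (rule axis_class_translate_subset[OF assms])

lemma axis_class_pow: "axis_class (w [^] (n :: nat)) = axis_class \<one>"
proof (rule axis_class_eq[of _ _ 1])
  have "w [^] n \<otimes> w [^] (1 :: nat) \<otimes> inv (w [^] n) = w [^] (1 :: nat) \<otimes> w [^] n \<otimes> inv (w [^] n)"
    by (simp only: nat_pow_mult w_in add.commute)
  then show "w [^] n \<otimes> w [^] (1 :: nat) \<otimes> inv (w [^] n) = \<one> \<otimes> w [^] (1 :: nat) \<otimes> inv \<one>"
    by (simp add: m_assoc)
qed auto

lemma reversing_one_class:
  assumes "g \<in> reversing" "h \<in> reversing"
  shows "axis_class g = axis_class h"
proof -
  obtain r r' where r: "g \<in> carrier G" "h \<in> carrier G" "r > (0::nat)" "r' > (0::nat)"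
    "g \<otimes> w [^] r \<otimes> inv g = inv (w [^] r)" "h \<otimes> w [^] r' \<otimes> inv h = inv (w [^] r')"
    using assms by (auto simp: reversing_def)
  have "g \<otimes> w [^] (r * r') \<otimes> inv g = inv (w [^] r) [^] r'"
    using conj_pow[OF r(1), of r r'] r(5) by simp
  also have "\<dots> = inv (w [^] r') [^] r"
    by (simp add: nat_pow_inv nat_pow_pow mult.commute)
  also have "\<dots> = h \<otimes> w [^] (r * r') \<otimes> inv h"
    using conj_pow[OF r(2), of r' r] r(6) by (simp add: mult.commute)
  finally show ?thesis using axis_class_eq[OF r(1,2)] r(3,4) by (metis nat_0_less_mult_iff)
qed

text \<open>
  An element that reverses the axis cannot preserve its direction, since no positive power
  of \<open>w\<close> is its own inverse.
\<close>
lemma reversing_not_axis: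
  assumes "g \<in> reversing"
  shows "axis_class g \<noteq> axis_class \<one>"
proof
  assume "axis_class g = axis_class \<one>"
  moreover obtain r where r: "g \<in> carrier G" "r > (0::nat)" "g \<otimes> w [^] r \<otimes> inv g = inv (w [^] r)"
    using assms by (auto simp: reversing_def)
  ultimately have "g \<in> axis_class \<one>" using axis_class_self by auto
  then obtain r' where r': "r' > (0::nat)" "w [^] r' = g \<otimes> w [^] r' \<otimes> inv g"
    by (auto simp: axis_class_def)
  have "w [^] (r * r') = (w [^] r') [^] r" by (simp add: nat_pow_pow mult.commute)
  also have "\<dots> = (g \<otimes> w [^] r' \<otimes> inv g) [^] r" by (simp only: r'(2)[symmetric])
  also have "\<dots> = (g \<otimes> w [^] r \<otimes> inv g) [^] r'" using r(1) by (simp add: conj_pow mult.commute)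
  also have "\<dots> = inv (w [^] (r * r'))" unfolding r(3) by (simp add: nat_pow_inv nat_pow_pow)
  finally have eq: "w [^] (r * r') = inv (w [^] (r * r'))" .
  have "w [^] (r * r' + r * r') = w [^] (r * r') \<otimes> w [^] (r * r')" by (simp add: nat_pow_mult)
  also have "\<dots> = inv (w [^] (r * r')) \<otimes> w [^] (r * r')" using eq by (rule arg_cong)
  also have "\<dots> = \<one>" by simp
  finally have "w [^] (r * r' + r * r') = \<one>" .
  then have "f (r * r' + r * r') = 0" by (simp add: len_def)
  moreover have "0 < r * r' + r * r'" using r(2) r'(1) by simp
  ultimately show False using len_pow_ge[of "r * r' + r * r'"] by (metis of_nat_0_less_iff not_le)
qed

end

section \<open>Randomly oriented axes\<close>

text \<open>
  The power \<open>k\<close> is large enough for two purposes: the shortcuts are long compared with the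
  discount, and a shortcut that runs backwards along the axis comes from an element that
  reverses the axis. The discount is \<open>a + 1\<close>, because the distance from \<open>x0\<close> to
  \<open>pt (w [^] (n * k))\<close> may fall short of \<open>n\<close> times the length of a shortcut by as much as
  \<open>n * a\<close>.
\<close>
locale axis_shortcuts = loxodromic S d \<delta> G \<phi> x0 w a
  for S :: "'s set" and d :: "'s \<Rightarrow> 's \<Rightarrow> real" and \<delta> :: real
    and G :: "('g, 'm) monoid_scheme" (structure) and \<phi> :: "'g \<Rightarrow> 's \<Rightarrow> 's" and x0 :: 's
    and w :: 'g and a :: real +
  fixes k :: nat
  assumes geodesic: "geodesic_space S d"
    and countable_G: "countable (carrier G)"
    and long_shortcut: "3 * (a + 1) + 3 * \<delta> + 3 \<le> len (w [^] k)"
    and reversed: "\<lbrakk>g \<in> carrier G; d (pt (w [^] (m :: nat))) (pt g) + len (w [^] k) + d (pt (g \<otimes> w [^] k)) x0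
        \<le> d (pt (w [^] m)) x0 + (5 * (a + 1) + 6 * \<delta> + 3)\<rbrakk> \<Longrightarrow> g \<in> reversing"
begin

definition exit :: "'g \<Rightarrow> 's" where "exit g = pt (g \<otimes> w [^] k)"

definition shortcut_cost :: "('g set \<Rightarrow> bool) \<Rightarrow> 'g \<Rightarrow> real" where
  "shortcut_cost \<omega> g = f k - (if \<omega> (axis_class g) then a + 1 else 0)"

lemma shortcuts: "shortcuts S d \<delta> (carrier G) pt exit (shortcut_cost \<omega>) (a + 1)"
proof
  show "d (pt i) (exit i) - (a + 1) \<le> shortcut_cost \<omega> i" "3 * (a + 1) + 3 * \<delta> + 3 \<le> d (pt i) (exit i)"
    if "i \<in> carrier G" for i
    using dist_pow'[OF that, of 0 k] that a_nonneg long_shortcut by (auto simp: exit_def shortcut_cost_def)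
  show "pt i \<in> S" "exit i \<in> S" if "i \<in> carrier G" for i
    using that by (auto simp: exit_def)
  show "0 \<le> a + 1" using a_nonneg by simp
qed

abbreviation D :: "('g set \<Rightarrow> bool) \<Rightarrow> 's \<Rightarrow> 's \<Rightarrow> real" where
  "D \<omega> \<equiv> route_dist d (carrier G) pt exit (shortcut_cost \<omega>)"

definition drift :: "'g \<Rightarrow> ('g set \<Rightarrow> bool) \<Rightarrow> real" where
  "drift s \<omega> = route_asymmetry d (carrier G) pt exit (shortcut_cost \<omega>) x0 (pt s)"

definition axes :: "'g set set" where "axes = axis_class ` carrier G"

text \<open>
  A coin toss for each class of parallel translates of the axis; the discount is available
  on the classes where the coin shows \<open>True\<close>.
\<close>
definition orientations :: "('g set \<Rightarrow> bool) measure" where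
  "orientations = PiM axes (\<lambda>_. measure_pmf (bernoulli_pmf (1 / 2)))"

text \<open>
  The restriction keeps the value in the product space, whose elements are \<open>undefined\<close>
  outside of \<open>axes\<close>.
\<close>
definition shift :: "'g \<Rightarrow> ('g set \<Rightarrow> bool) \<Rightarrow> 'g set \<Rightarrow> bool" where
  "shift s \<omega> = (\<lambda>c\<in>axes. \<omega> ((\<lambda>x. inv s \<otimes> x) ` c))"

lemma translate_axes: "s \<in> carrier G \<Longrightarrow> c \<in> axes \<Longrightarrow> (\<lambda>x. s \<otimes> x) ` c \<in> axes"
  by (auto simp: axes_def axis_class_translate)

lemma axes_carrier: "c \<in> axes \<Longrightarrow> c \<subseteq> carrier G"
  by (auto simp: axes_def axis_class_def)

lemma translate_translate:
  assumes "s \<in> carrier G" "t \<in> carrier G" "c \<subseteq> carrier G"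
  shows "(\<lambda>x. s \<otimes> x) ` (\<lambda>x. t \<otimes> x) ` c = (\<lambda>x. s \<otimes> t \<otimes> x) ` c"
  using assms by (auto simp: image_comp m_assoc intro!: image_cong)

lemma translate_one: "c \<subseteq> carrier G \<Longrightarrow> (\<lambda>x. \<one> \<otimes> x) ` c = c"
  by (force simp: image_iff)

lemma prob_space_orientations: "prob_space orientations"
  unfolding orientations_def by (intro prob_space_PiM measure_pmf.prob_space_axioms)

lemma space_orientations: "space orientations = axes \<rightarrow>\<^sub>E UNIV"
  by (simp add: orientations_def space_PiM)

lemma shift_measurable: "s \<in> carrier G \<Longrightarrow> shift s \<in> orientations \<rightarrow>\<^sub>M orientations"
  unfolding shift_def orientations_def
  by (intro measurable_restrict measurable_component_singleton translate_axes) auto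

lemma shift_preserves:
  assumes s: "s \<in> carrier G"
  shows "distr orientations orientations (shift s) = orientations"
proof -
  have inj: "inj_on ((`) (\<lambda>x. inv s \<otimes> x)) axes"
  proof (rule inj_on_inverseI[where g = "(`) (\<lambda>x. s \<otimes> x)"])
    fix c assume "c \<in> axes"
    then have "c \<subseteq> carrier G" by (rule axes_carrier)
    then show "(\<lambda>x. s \<otimes> x) ` (\<lambda>x. inv s \<otimes> x) ` c = c"
      using s by (simp add: translate_translate translate_one)
  qed
  have maps: "(`) (\<lambda>x. inv s \<otimes> x) \<in> axes \<rightarrow> axes" using translate_axes[of "inv s"] s by auto
  show ?thesis
    using distr_PiM_reindex[where M = "\<lambda>_. measure_pmf (bernoulli_pmf (1 / 2))", OF _ inj maps]
    by (simp add: orientations_def shift_def[abs_def] measure_pmf.prob_space_axioms)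
qed

lemma shift_one: "\<omega> \<in> space orientations \<Longrightarrow> shift \<one> \<omega> = \<omega>"
  by (auto simp: shift_def space_orientations fun_eq_iff translate_one axes_carrier PiE_def extensional_def restrict_def)

lemma shift_mult:
  assumes "s \<in> carrier G" "t \<in> carrier G"
  shows "shift (s \<otimes> t) \<omega> = shift s (shift t \<omega>)"
  using assms
  by (auto simp: shift_def fun_eq_iff restrict_def translate_axes translate_translate axes_carrier inv_mult_group)

lemma shortcut_cost_shift:
  assumes "s \<in> carrier G" "g \<in> carrier G"
  shows "shortcut_cost (shift (inv s) \<omega>) g = shortcut_cost \<omega> (s \<otimes> g)"
  using assms by (simp add: shortcut_cost_def shift_def axis_class_translate axes_def)

lemma route_cost_cong:
  assumes "\<And>i. i \<in> set is \<Longrightarrow> c i = c' i"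
  shows "route_cost d pt exit c x is y = route_cost d pt exit c' x is y"
  using assms by (induction "is" arbitrary: x) auto

lemma D_shift:
  assumes s: "s \<in> carrier G" and S: "x \<in> S" "y \<in> S"
  shows "D (shift (inv s) \<omega>) x y = D \<omega> (\<phi> s x) (\<phi> s y)"
proof -
  have "D (shift (inv s) \<omega>) x y = route_dist d (carrier G) pt exit (\<lambda>g. shortcut_cost \<omega> (s \<otimes> g)) x y"
    unfolding route_dist_def
    by (intro arg_cong[where f = Inf] image_cong refl route_cost_cong)
      (auto simp: shortcut_cost_shift s)
  also have "\<dots> = D \<omega> (\<phi> s x) (\<phi> s y)"
    using route_dist_translate[OF s _ S, of "w [^] k" "shortcut_cost \<omega>"] by (simp add: exit_def[abs_def])
  finally show ?thesis .
qed

lemma drift_one: "drift \<one> \<omega> = 0"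
  by (simp add: drift_def route_asymmetry_def)

text \<open>
  By invariance, the second term is the asymmetry of \<open>pt s\<close> and \<open>pt (s \<otimes> t)\<close> for the
  orientation \<open>\<omega>\<close>, so the three terms belong to one triangle.
\<close>
lemma drift_defect:
  assumes s: "s \<in> carrier G" and t: "t \<in> carrier G"
  shows "\<bar>drift (s \<otimes> t) \<omega> - drift t (shift (inv s) \<omega>) - drift s \<omega>\<bar> \<le> 27 * (a + 1) + 60 * \<delta> + 15"
proof -
  interpret sc: shortcuts S d \<delta> "carrier G" pt exit "shortcut_cost \<omega>" "a + 1" by (rule shortcuts)
  have "\<phi> s x0 = pt s" by (simp add: pt_def)
  then have "drift t (shift (inv s) \<omega>) = sc.asymmetry (pt s) (pt (s \<otimes> t))"
    using s t by (simp add: drift_def route_asymmetry_def D_shift action_pt)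
  then show ?thesis
    using sc.asymmetry_quasi_additive[OF geodesic basepoint, of "pt s" "pt (s \<otimes> t)"] s t
    by (simp add: drift_def abs_minus_commute algebra_simps)
qed

lemma drift_bound: "\<bar>drift s \<omega>\<bar> \<le> len s"
proof -
  interpret sc: shortcuts S d \<delta> "carrier G" pt exit "shortcut_cost \<omega>" "a + 1" by (rule shortcuts)
  show ?thesis
    using sc.rdist_le[of x0 "pt s"] sc.rdist_le[of "pt s" x0] sc.rdist_nonneg[of x0 "pt s"]
      sc.rdist_nonneg[of "pt s" x0]
    by (simp add: drift_def route_asymmetry_def len_def commute)
qed

lemma D_measurable: "(\<lambda>\<omega>. D \<omega> x y) \<in> borel_measurable orientations"
proof -
  have c: "(\<lambda>\<omega>. shortcut_cost \<omega> g) \<in> borel_measurable orientations" if "g \<in> carrier G" for g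
  proof -
    have [measurable]: "(\<lambda>\<omega>. \<omega> (axis_class g)) \<in> orientations \<rightarrow>\<^sub>M count_space UNIV"
    proof -
      have "(\<lambda>\<omega>. \<omega> (axis_class g)) \<in> orientations \<rightarrow>\<^sub>M measure_pmf (bernoulli_pmf (1 / 2))"
        unfolding orientations_def using that by (intro measurable_component_singleton) (simp add: axes_def)
      then show ?thesis by simp
    qed
    show ?thesis unfolding shortcut_cost_def by measurable
  qed
  have "(\<lambda>\<omega>. route_cost d pt exit (shortcut_cost \<omega>) x gs y) \<in> borel_measurable orientations"
    if "gs \<in> lists (carrier G)" for gs
    using that by (induction gs arbitrary: x) (auto intro!: borel_measurable_add c)
  then show ?thesis
    unfolding route_dist_def using countable_G by (intro borel_measurable_cINF_real) auto
qed

lemma drift_integrable: "integrable orientations (drift s)"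
proof -
  interpret prob_space orientations by (rule prob_space_orientations)
  have "drift s \<in> borel_measurable orientations"
    unfolding drift_def route_asymmetry_def by (intro borel_measurable_diff D_measurable)
  then show ?thesis
    using drift_bound by (intro integrable_const_bound[where B = "len s"]) auto
qed

definition oriented_axis :: "('g set \<Rightarrow> bool) set" where
  "oriented_axis = {\<omega> \<in> space orientations. \<omega> (axis_class \<one>) \<and> (\<forall>g\<in>reversing. \<not> \<omega> (axis_class g))}"

text \<open>
  Going forward, the route through the shortcuts along the axis saves \<open>a + 1\<close> on each of \<open>n\<close>
  pieces. Going back, all shortcuts on a nearly optimal route run backwards along the axis,
  so their class is switched off and nothing is saved. The difference per piece is \<open>a + 1\<close>
  from the discount less at most \<open>a\<close> from the failure of additivity of lengths.
\<close>
lemma drift_oriented_axis: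
  assumes \<omega>: "\<omega> \<in> oriented_axis"
  shows "drift (w [^] (n * k)) \<omega> \<le> 1 - real n"
proof -
  interpret sc: shortcuts S d \<delta> "carrier G" pt exit "shortcut_cost \<omega>" "a + 1" by (rule shortcuts)
  have cost1: "shortcut_cost \<omega> (w [^] i) = f k - (a + 1)" for i :: nat
    using \<omega> by (simp add: shortcut_cost_def oriented_axis_def axis_class_pow)
  have forward: "D \<omega> x0 (pt (w [^] (n * k))) \<le> real n * (f k - (a + 1))"
  proof (induction n)
    case 0
    then show ?case using sc.rdist_le[of x0 x0] by simp
  next
    case (Suc n)
    have pts: "pt (w [^] (n * k)) \<in> S" "pt (w [^] (Suc n * k)) \<in> S"
      by (rule pt_in, rule nat_pow_closed, rule w_in)+
    have ex: "exit (w [^] (n * k)) = pt (w [^] (Suc n * k))"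
      by (simp add: exit_def nat_pow_mult add.commute)
    have "D \<omega> (pt (w [^] (n * k))) (pt (w [^] (Suc n * k)))
        \<le> route_cost d pt exit (shortcut_cost \<omega>) (pt (w [^] (n * k))) [w [^] (n * k)] (pt (w [^] (Suc n * k)))"
      by (rule sc.rdist_le_cost) simp
    also have "\<dots> = f k - (a + 1)" using pts by (simp add: cost1 ex del: mult_Suc)
    finally show ?case
      using Suc sc.rdist_triangle[OF basepoint pts] by (simp add: algebra_simps)
  qed
  obtain gs where gs: "sc.near_optimal (pt (w [^] (n * k))) gs x0" by (rule sc.near_optimal_exists)
  have pt: "pt (w [^] (n * k)) \<in> S" by simp
  have undiscounted: "d (pt g) (exit g) \<le> shortcut_cost \<omega> g" if g_in: "g \<in> set gs" for g
  proof -
    have g: "g \<in> carrier G" using gs g_in by (auto simp: sc.near_optimal_def)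
    have pg: "d (pt g) (exit g) = f k" using dist_pow'[OF g, of 0 k] g by (simp add: exit_def)
    obtain us vs where "gs = us @ g # vs" using split_list[OF g_in] by blast
    then have "g \<in> reversing"
      using sc.near_optimal_passes[of "pt (w [^] (n * k))" us g vs x0] gs g pt
      by (intro reversed) (simp_all add: pg, simp add: exit_def)
    then show ?thesis using \<omega> pg by (simp add: shortcut_cost_def oriented_axis_def)
  qed
  have "d x y \<le> route_cost d pt exit (shortcut_cost \<omega>) x is y"
    if "x \<in> S" "y \<in> S" "set is \<subseteq> set gs" "is \<in> lists (carrier G)" for x y "is"
    using that
  proof (induction "is" arbitrary: x)
    case (Cons i "is")
    have i: "pt i \<in> S" "exit i \<in> S" using Cons.prems by (auto simp: exit_def)
    have "d (exit i) y \<le> route_cost d pt exit (shortcut_cost \<omega>) (exit i) is y"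
      using Cons.IH[OF i(2)] Cons.prems by simp
    moreover have "d (pt i) (exit i) \<le> shortcut_cost \<omega> i" using undiscounted Cons.prems by simp
    ultimately show ?case
      using triangle[OF \<open>x \<in> S\<close> i(1) \<open>y \<in> S\<close>] triangle[OF i \<open>y \<in> S\<close>]
      unfolding route_cost.simps by linarith
  qed simp
  from this[OF pt basepoint order_refl] have "d (pt (w [^] (n * k))) x0 \<le> D \<omega> (pt (w [^] (n * k))) x0 + 1"
    using gs by (auto simp: sc.near_optimal_def)
  moreover have "real n * (f k - a) \<le> d (pt (w [^] (n * k))) x0"
    using len_pow_mult[of n k] by (simp add: len_def commute)
  ultimately show ?thesis
    using forward by (simp add: drift_def route_asymmetry_def algebra_simps)
qed

text \<open>
  The event prescribes the results of at most two coins, since the elements of \<open>reversing\<close>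
  form at most one class, which is not the class of the axis.
\<close>
lemma prob_oriented_axis:
  "oriented_axis \<in> sets orientations" "1 / 4 \<le> measure orientations oriented_axis"
proof -
  define J where "J = insert (axis_class \<one>) (axis_class ` reversing)"
  define X where "X c = (if c = axis_class \<one> then {True} else {False})" for c
  have fin: "finite J" "card J \<le> 2"
  proof -
    have single: "axis_class ` reversing \<subseteq> {axis_class (SOME g. g \<in> reversing)}"
    proof
      fix c assume "c \<in> axis_class ` reversing"
      then obtain g where g: "g \<in> reversing" "c = axis_class g" by blast
      have "(SOME g. g \<in> reversing) \<in> reversing" using g(1) by (rule someI)
      from reversing_one_class[OF g(1) this] show "c \<in> {axis_class (SOME g. g \<in> reversing)}"
        unfolding g(2) by (rule singleton_iff[THEN iffD2])
    qed
    have 1: "finite (axis_class ` reversing)" using single by (rule finite_subset) simp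
    have "card (axis_class ` reversing) \<le> 1" using card_mono[OF _ single] by simp
    then show "finite J" "card J \<le> 2" using 1 unfolding J_def by (simp_all add: card_insert_if)
  qed
  have "reversing \<subseteq> carrier G" unfolding reversing_def by (rule Collect_subset)
  then have sub: "J \<subseteq> axes" unfolding J_def axes_def using one_closed by blast
  have X_one: "X (axis_class \<one>) = {True}" by (simp add: X_def)
  have X_rev: "X (axis_class g) = {False}" if "g \<in> reversing" for g
    using reversing_not_axis[OF that] by (simp add: X_def)
  interpret product_prob_space "\<lambda>_. measure_pmf (bernoulli_pmf (1 / 2))" axes
    by unfold_locales
  have eq: "oriented_axis = prod_emb axes (\<lambda>_. measure_pmf (bernoulli_pmf (1 / 2))) J (Pi\<^sub>E J X)"
  proof (rule Set.set_eqI)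
    fix \<omega>
    have "\<omega> \<in> oriented_axis \<longleftrightarrow> \<omega> \<in> axes \<rightarrow>\<^sub>E UNIV \<and> (\<forall>c\<in>J. \<omega> c \<in> X c)"
      by (simp add: oriented_axis_def space_orientations J_def X_one X_rev)
    also have "\<dots> \<longleftrightarrow> \<omega> \<in> (\<Pi>\<^sub>E c\<in>axes. if c \<in> J then X c else UNIV)"
      using sub unfolding PiE_iff by (simp add: subset_iff) blast
    finally show "\<omega> \<in> oriented_axis \<longleftrightarrow>
        \<omega> \<in> prod_emb axes (\<lambda>_. measure_pmf (bernoulli_pmf (1 / 2))) J (Pi\<^sub>E J X)"
      using sub by (simp only: prod_emb_PiE subset_UNIV space_measure_pmf)
  qed
  show "oriented_axis \<in> sets orientations"
    unfolding eq orientations_def using fin sub by (intro sets_PiM_I) auto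
  have "measure orientations oriented_axis = (\<Prod>c\<in>J. measure (measure_pmf (bernoulli_pmf (1 / 2))) (X c))"
    unfolding eq orientations_def using fin sub by (intro measure_PiM_emb) auto
  also have "\<dots> = (\<Prod>c\<in>J. 1 / 2)"
    by (intro prod.cong) (simp_all add: X_def measure_pmf_single)
  also have "\<dots> = (1 / 2) ^ card J" by simp
  also have "\<dots> \<ge> (1 / 2) ^ 2" using fin(2) by (intro power_decreasing) auto
  finally show "1 / 4 \<le> measure orientations oriented_axis" by (simp add: power2_eq_square)
qed

lemma drift_unbounded: "\<exists>s\<in>carrier G. B < (LINT \<omega>|orientations. \<bar>drift s \<omega>\<bar>)"
proof -
  interpret prob_space orientations by (rule prob_space_orientations)
  obtain n :: nat where n: "4 * B + 1 < real n" "1 < real n"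
    using reals_Archimedean2[of "max (4 * B + 1) 1"] by auto
  have "(real n - 1) * measure orientations oriented_axis
      = (LINT \<omega>|orientations. (real n - 1) * indicator oriented_axis \<omega>)"
    using prob_oriented_axis(1) by simp
  also have "\<dots> \<le> (LINT \<omega>|orientations. \<bar>drift (w [^] (n * k)) \<omega>\<bar>)"
  proof (rule integral_mono)
    show "integrable orientations (\<lambda>\<omega>. (real n - 1) * indicator oriented_axis \<omega>)"
      using prob_oriented_axis(1) by (intro integrable_mult_right integrable_real_indicator) (auto simp: emeasure_eq_measure)
    show "integrable orientations (\<lambda>\<omega>. \<bar>drift (w [^] (n * k)) \<omega>\<bar>)" using drift_integrable by simp
    show "(real n - 1) * indicator oriented_axis \<omega> \<le> \<bar>drift (w [^] (n * k)) \<omega>\<bar>" for \<omega>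
      using drift_oriented_axis[of \<omega> n] by (auto split: split_indicator)
  qed
  also have "(real n - 1) * measure orientations oriented_axis \<ge> (real n - 1) * (1 / 4)"
    using prob_oriented_axis(2) n(2) by (intro mult_left_mono) auto
  finally show ?thesis using n(1) by (intro bexI[of _ "w [^] (n * k)"]) auto
qed

lemma orientations_inj: "\<exists>j :: ('g set \<Rightarrow> bool) \<Rightarrow> real. inj_on j (space orientations)"
proof -
  obtain code :: "nat set \<Rightarrow> real" where code: "inj code"
    using nat_sets_eqpoll_reals by (auto simp: eqpoll_def bij_betw_def)
  have c: "countable axes" unfolding axes_def using countable_G by simp
  have "inj_on (\<lambda>\<omega>. to_nat_on axes ` {c \<in> axes. \<omega> c}) (space orientations)"
  proof (rule inj_onI)
    fix \<omega> \<omega>' assume \<omega>: "\<omega> \<in> space orientations" "\<omega>' \<in> space orientations"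
      and eq: "to_nat_on axes ` {c \<in> axes. \<omega> c} = to_nat_on axes ` {c \<in> axes. \<omega>' c}"
    have "{c \<in> axes. \<omega> c} = {c \<in> axes. \<omega>' c}"
      using eq inj_on_image_eq_iff[OF inj_on_to_nat_on[OF c]] by auto
    then show "\<omega> = \<omega>'"
      using \<omega> unfolding space_orientations by (intro PiE_ext[of \<omega> axes _ \<omega>']) auto
  qed
  then have "inj_on (code \<circ> (\<lambda>\<omega>. to_nat_on axes ` {c \<in> axes. \<omega> c})) (space orientations)"
    using code by (intro comp_inj_on) (auto intro: inj_on_subset)
  then show ?thesis by blast
qed

lemma exists_L1_action:
  "\<exists>(M :: real measure) E \<pi> b.
    L1_closed_subspace M E \<and> L1_affine_action G M E \<pi> b \<and>
    L1_uniformly_lipschitz G M E \<pi> b \<and> L1_unbounded_orbits G M E \<pi> b"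
proof -
  obtain j :: "('g set \<Rightarrow> bool) \<Rightarrow> real" where j: "inj_on j (space orientations)"
    using orientations_inj by blast
  show ?thesis
    by (rule L1_action_of_quasi_cocycle[where P = orientations and \<alpha> = shift and F = drift and j = j])
      (use j countable_G prob_space_orientations shift_measurable shift_preserves shift_one shift_mult
        drift_integrable drift_one drift_defect drift_unbounded in \<open>auto intro: group_axioms\<close>)
qed

end

section \<open>Acylindrically hyperbolic groups\<close>

theorem theorem1p3:
  fixes G :: "('g, 'm) monoid_scheme"
  assumes "acylindrically_hyperbolic TYPE('s) G"
    and "countable (carrier G)"
  shows "\<exists>(M :: real measure) E \<pi> b.
    L1_closed_subspace M E \<and> L1_affine_action G M E \<pi> b \<and>
    L1_uniformly_lipschitz G M E \<pi> b \<and> L1_unbounded_orbits G M E \<pi> b"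
proof -
  obtain S :: "'s set" and d \<phi> where G: "group G" and hyp: "hyperbolic_space S d"
    and isom: "isometric_action G S d \<phi>" and acyl: "acylindrical_action G S d \<phi>"
    and nonel: "non_elementary_action G S d \<phi>"
    using assms(1) unfolding acylindrically_hyperbolic_def by blast
  have metric: "Metric_space S d" and geo: "geodesic_space S d" and "gromov_hyperbolic S d"
    using hyp by (simp_all add: hyperbolic_space_def)
  then obtain \<delta> where \<delta>: "0 \<le> \<delta>" "\<And>w x y z. \<lbrakk>w \<in> S; x \<in> S; y \<in> S; z \<in> S\<rbrakk> \<Longrightarrow>
      gromov_product d w x z \<ge> min (gromov_product d w x y) (gromov_product d w y z) - \<delta>"
    unfolding gromov_hyperbolic_def by blast
  have hm: "hyperbolic_metric S d \<delta>"
    using metric \<delta> by (simp add: hyperbolic_metric_def hyperbolic_metric_axioms_def)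
  obtain x0 B where x0: "x0 \<in> S" and B: "0 \<le> B"
    "\<And>R. \<exists>g\<in>carrier G. \<exists>h\<in>carrier G. R \<le> d x0 (\<phi> g x0) \<and> R \<le> d x0 (\<phi> h x0) \<and>
      d (\<phi> g x0) x0 + d x0 (\<phi> h x0) - d (\<phi> g x0) (\<phi> h x0) \<le> B"
    using limit_points_give_directions[OF hm isom nonel] by blast
  interpret isometric_group S d \<delta> G \<phi> x0
    using hm G isom x0
    by (simp add: isometric_group_def isometric_group_axioms_def isometric_action_def)
  have "\<exists>w\<in>carrier G. len w + (4 * \<delta> + 1) \<le> len (w \<otimes>\<^bsub>G\<^esub> w)"
    by (rule exists_loxodromic[of B]) (use B \<delta>(1) in \<open>simp_all add: len_def pt_def excess_def\<close>)
  then obtain w where w: "w \<in> carrier G" "len w + (4 * \<delta> + 1) \<le> len (w \<otimes>\<^bsub>G\<^esub> w)" by blast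
  obtain a where a: "0 \<le> a"
    "\<And>i j :: nat. len (w [^]\<^bsub>G\<^esub> i) + len (w [^]\<^bsub>G\<^esub> j) \<le> len (w [^]\<^bsub>G\<^esub> (i + j)) + a"
    "\<And>n :: nat. real n \<le> len (w [^]\<^bsub>G\<^esub> n)"
    using loxodromic_orbit[OF w] by blast
  interpret loxodromic S d \<delta> G \<phi> x0 w a
    by unfold_locales (rule w(1) a)+
  have b: "0 \<le> 5 * (a + 1) + 6 * \<delta> + 3" using a(1) \<delta>(1) by simp
  obtain k0 :: nat where k0: "\<forall>k\<ge>k0. \<forall>m :: nat. \<forall>g\<in>carrier G.
      d (pt (w [^]\<^bsub>G\<^esub> m)) (pt g) + len (w [^]\<^bsub>G\<^esub> k) + d (pt (g \<otimes>\<^bsub>G\<^esub> w [^]\<^bsub>G\<^esub> k)) x0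
        \<le> d (pt (w [^]\<^bsub>G\<^esub> m)) x0 + (5 * (a + 1) + 6 * \<delta> + 3) \<longrightarrow> g \<in> reversing"
    using reversed_segment_reverses_axis[OF acyl b] by blast
  define k where "k = max k0 (nat \<lceil>3 * (a + 1) + 3 * \<delta> + 3\<rceil>)"
  have k: "k \<ge> k0" "3 * (a + 1) + 3 * \<delta> + 3 \<le> len (w [^]\<^bsub>G\<^esub> k)"
    using a(3)[of k] by (simp_all add: k_def) linarith
  interpret axis_shortcuts S d \<delta> G \<phi> x0 w a k
  proof unfold_locales
    show "g \<in> reversing" if "g \<in> carrier G"
      "d (pt (w [^]\<^bsub>G\<^esub> (m :: nat))) (pt g) + len (w [^]\<^bsub>G\<^esub> k) + d (pt (g \<otimes>\<^bsub>G\<^esub> w [^]\<^bsub>G\<^esub> k)) x0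
        \<le> d (pt (w [^]\<^bsub>G\<^esub> m)) x0 + (5 * (a + 1) + 6 * \<delta> + 3)" for g m
      using k0 k(1) that by blast
  qed (use geo assms(2) k(2) in simp_all)
  show ?thesis by (rule exists_L1_action)
qed

end
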